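(* Let $(X,\tau)$ be a Hausdorff topological space, let $\kappa$ be a cardinal, let $\lambda$ be an ordinal, and let $\{X_\alpha : \alpha < \lambda\}$ be an increasing chain of subspaces of $X$ (that is, $X_\alpha \subset X_\beta$ whenever $\alpha \le \beta < \lambda$, each $X_\alpha$ carrying the subspace topology) such that $X = \bigcup_{\alpha<\lambda} X_\alpha$ and $FL(X_\alpha)\cdot F(X_\alpha)\cdot \psi(X_\alpha) \le \kappa$ for every $\alpha < \lambda$. Then $|X| \le 2^\kappa$.
   Context: All spaces are assumed to be Hausdorff. For a space $Y$: A free sequence in $Y$ is a set $\{x_\alpha : \alpha < \mu\} \subset Y$, indexed by an ordinal $\mu$, such that for every $\beta < \mu$ we have $\overline{\{x_\alpha : \alpha<\beta\}} \cap \overline{\{x_\alpha : \beta \le \alpha < \mu\}} = \emptyset$ (closures taken in $Y$). $F(Y)$ is the supremum of the cardinalities of free sequences in $Y$. The Lindelöf number $L(Y)$ is the least cardinal $\kappa$ such that every open cover of $Y$ has a subcover of cardinality at most $\kappa$. $FL(Y)$ is the supremum of $L(\overline{S})$ over all free sequences $S$ in $Y$ (closure taken in $Y$). The pseudocharacter is $\psi(Y) = \sup\{\psi(x,Y) : x \in Y\}$, where $\psi(x,Y)$ is the least cardinality of a family $\mathcal{U}$ of open subsets of $Y$ with $\bigcap \mathcal{U} = \{x\}$. *)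

theory Defs
  imports "HOL-Analysis.T1_Spaces"
begin

unbundle cardinal_syntax

section \<open>Least cardinals\<close>

text \<open>
  Cardinals are \<^const>\<open>Card_order\<close> relations, compared up to order isomorphism, so
  \<open>least_cardinal P\<close> is determined up to \<open>=o\<close>. It ranges over cardinals realised on the type
  \<open>'a\<close> of points. This loses nothing for the invariants below: each of them is bounded by the
  cardinality of the space, and the \<open>_least\<close> lemmas show leastness among the cardinals of every type.
\<close>

definition least_cardinal :: "('a rel \<Rightarrow> bool) \<Rightarrow> 'a rel" where
  "least_cardinal P = (SOME r. Card_order r \<and> P r \<and> (\<forall>r'. Card_order r' \<and> P r' \<longrightarrow> r \<le>o r'))"

section \<open>Cardinal functions\<close>

definition lindelof_number :: "'a topology \<Rightarrow> 'a rel" where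
  "lindelof_number Y = least_cardinal (\<lambda>r.
     \<forall>\<U>. (\<forall>U\<in>\<U>. openin Y U) \<and> \<Union>\<U> = topspace Y \<longrightarrow>
       (\<exists>\<V>\<subseteq>\<U>. \<Union>\<V> = topspace Y \<and> |\<V>| \<le>o r))"

text \<open>
  The ordinal \<open>\<mu>\<close> is a well-order; its elements below \<open>\<beta>\<close> form \<^term>\<open>underS \<mu> \<beta>\<close>, those
  at or above \<open>\<beta>\<close> form \<^term>\<open>above \<mu> \<beta>\<close>.
\<close>

definition free_sequence :: "'a topology \<Rightarrow> 'i rel \<Rightarrow> ('i \<Rightarrow> 'a) \<Rightarrow> bool" where
  "free_sequence Y \<mu> x \<longleftrightarrow>
     Well_order \<mu> \<and> x ` Field \<mu> \<subseteq> topspace Y \<and>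
     (\<forall>\<beta>\<in>Field \<mu>. (Y closure_of (x ` underS \<mu> \<beta>)) \<inter> (Y closure_of (x ` above \<mu> \<beta>)) = {})"

text \<open>
  Indexing by well-orders on \<open>'a\<close> suffices because the enumeration of a free sequence is
  injective; see \<open>free_sequence_imp_free_set\<close>.
\<close>

definition free_set :: "'a topology \<Rightarrow> 'a set \<Rightarrow> bool" where
  "free_set Y S \<longleftrightarrow> (\<exists>(\<mu> :: 'a rel) x. free_sequence Y \<mu> x \<and> S = x ` Field \<mu>)"

definition free_number :: "'a topology \<Rightarrow> 'a rel" where
  "free_number Y = least_cardinal (\<lambda>r. \<forall>S. free_set Y S \<longrightarrow> |S| \<le>o r)"

definition free_lindelof_number :: "'a topology \<Rightarrow> 'a rel" where
  "free_lindelof_number Y = least_cardinal (\<lambda>r.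
     \<forall>S. free_set Y S \<longrightarrow> lindelof_number (subtopology Y (Y closure_of S)) \<le>o r)"

text \<open>The intersection is taken inside the space, so an empty family has intersection \<^term>\<open>topspace Y\<close>.\<close>

definition pseudocharacter_at :: "'a topology \<Rightarrow> 'a \<Rightarrow> 'a rel" where
  "pseudocharacter_at Y x = least_cardinal (\<lambda>r.
     \<exists>\<U>. (\<forall>U\<in>\<U>. openin Y U) \<and> topspace Y \<inter> \<Inter>\<U> = {x} \<and> |\<U>| =o r)"

definition pseudocharacter :: "'a topology \<Rightarrow> 'a rel" where
  "pseudocharacter Y = least_cardinal (\<lambda>r. \<forall>x\<in>topspace Y. pseudocharacter_at Y x \<le>o r)"

section \<open>The invariants are well defined\<close>

lemma least_cardinal:
  fixes P :: "'a rel \<Rightarrow> bool"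
  assumes l: "l = least_cardinal P" and s: "Card_order s" "P s"
  shows "Card_order l" and "P l" and "\<And>r'. Card_order r' \<Longrightarrow> P r' \<Longrightarrow> l \<le>o r'"
proof -
  let ?Q = "{r. Card_order r \<and> P r}"
  have "s \<in> ?Q" using s by simp
  then obtain r where r: "r \<in> ?Q" "\<And>t. (t, r) \<in> ordLess \<Longrightarrow> t \<notin> ?Q"
    by (rule wfE_min[OF wf_ordLess]) blast
  have "r \<le>o r'" if "Card_order r'" "P r'" for r'
  proof -
    have "\<not> r' <o r" using r(2) that by blast
    then show ?thesis
      using r(1) that ordLess_or_ordLeq[of r' r] unfolding card_order_on_def by blast
  qed
  with r(1) have "\<exists>r. Card_order r \<and> P r \<and> (\<forall>r'. Card_order r' \<and> P r' \<longrightarrow> r \<le>o r')"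
    by blast
  from someI_ex[OF this]
  have *: "Card_order l \<and> P l \<and> (\<forall>r'. Card_order r' \<and> P r' \<longrightarrow> l \<le>o r')"
    unfolding l least_cardinal_def .
  show "Card_order l" "P l" using * by simp_all
  show "\<And>r'. Card_order r' \<Longrightarrow> P r' \<Longrightarrow> l \<le>o r'" using * by simp
qed

lemma least_cardinal_le:
  fixes P :: "'a rel \<Rightarrow> bool" and k :: "'k rel"
  assumes l: "l = least_cardinal P" and s: "Card_order s" "P s" and k: "Card_order k"
    and P: "\<And>t :: 'a rel. t =o k \<Longrightarrow> P t"
  shows "l \<le>o k"
proof (rule ccontr)
  assume nle: "\<not> l \<le>o k"
  have "Card_order l" using least_cardinal(1)[OF l s] .
  then have "k <o l"
    using nle ordLess_or_ordLeq[of k l] k unfolding card_order_on_def by blast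
  then obtain p :: "'a rel" where p: "k =o p"
    using internalize_ordLess[of k l] by blast
  have pk: "p =o k" using p by (rule ordIso_symmetric)
  have cp: "Card_order p" using Card_order_ordIso[OF k pk] .
  have "l \<le>o p" using least_cardinal(3)[OF l s cp P[OF pk]] .
  then have "l \<le>o k" using pk by (rule ordLeq_ordIso_trans)
  with nle show False by blast
qed

lemma ordLeq_cong_right: "r \<le>o t \<longleftrightarrow> r \<le>o k" if "t =o k"
  by (rule iffI) (erule ordLeq_ordIso_trans, rule that, erule ordLeq_ordIso_trans,
    rule ordIso_symmetric[OF that])

lemma lindelof_number_bound:
  assumes "\<forall>U\<in>\<U>. openin Y U" "\<Union>\<U> = topspace Y"
  shows "\<exists>\<V>\<subseteq>\<U>. \<Union>\<V> = topspace Y \<and> |\<V>| \<le>o |topspace Y|"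
proof -
  have "\<forall>y\<in>topspace Y. \<exists>U\<in>\<U>. y \<in> U" using assms(2) by blast
  then obtain f where f: "\<forall>y\<in>topspace Y. f y \<in> \<U> \<and> y \<in> f y" by metis
  show ?thesis
    by (rule exI[of _ "f ` topspace Y"]) (use f assms(2) in \<open>auto intro: card_of_image\<close>)
qed

lemma lindelof_number:
  shows "Card_order (lindelof_number Y)"
    and "\<forall>\<U>. (\<forall>U\<in>\<U>. openin Y U) \<and> \<Union>\<U> = topspace Y \<longrightarrow>
           (\<exists>\<V>\<subseteq>\<U>. \<Union>\<V> = topspace Y \<and> |\<V>| \<le>o lindelof_number Y)"
  by (rule least_cardinal(1,2)[OF lindelof_number_def[of Y] card_of_Card_order[of "topspace Y"]]; simp add: lindelof_number_bound)+

lemma lindelof_number_least: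
  fixes k :: "'k rel"
  assumes "Card_order k"
    and "\<And>\<U>. \<lbrakk>\<forall>U\<in>\<U>. openin Y U; \<Union>\<U> = topspace Y\<rbrakk> \<Longrightarrow>
           \<exists>\<V>\<subseteq>\<U>. \<Union>\<V> = topspace Y \<and> |\<V>| \<le>o k"
  shows "lindelof_number Y \<le>o k"
  by (rule least_cardinal_le[OF lindelof_number_def[of Y] card_of_Card_order[of "topspace Y"]])
     (use assms in \<open>simp_all add: lindelof_number_bound ordLeq_cong_right\<close>)

lemma lindelof_number_le_card: "lindelof_number Y \<le>o |topspace Y|"
  by (rule lindelof_number_least) (simp_all add: card_of_Card_order lindelof_number_bound)

lemma free_sequence_inj:
  assumes "free_sequence Y \<mu> x"
  shows "inj_on x (Field \<mu>)"
proof -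
  have wo: "Well_order \<mu>" and sub: "x ` Field \<mu> \<subseteq> topspace Y"
    and disj: "\<And>\<beta>. \<beta> \<in> Field \<mu> \<Longrightarrow>
      (Y closure_of (x ` underS \<mu> \<beta>)) \<inter> (Y closure_of (x ` above \<mu> \<beta>)) = {}"
    using assms unfolding free_sequence_def by auto
  have *: "x a \<noteq> x b" if "(a, b) \<in> \<mu>" "a \<noteq> b" for a b
  proof
    assume eq: "x a = x b"
    have F: "a \<in> Field \<mu>" "b \<in> Field \<mu>" using that by (auto simp: Field_def)
    have "(b, b) \<in> \<mu>"
      using wo F unfolding order_on_defs refl_on_def by blast
    then have "a \<in> underS \<mu> b" "b \<in> above \<mu> b"
      using that unfolding underS_def above_def by auto
    then have "x b \<in> x ` underS \<mu> b" "x b \<in> x ` above \<mu> b"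
      using eq by (metis imageI)+
    moreover have "x b \<in> topspace Y" using sub F by blast
    ultimately have "x b \<in> (Y closure_of (x ` underS \<mu> b)) \<inter> (Y closure_of (x ` above \<mu> b))"
      unfolding in_closure_of Int_iff by blast
    then show False using disj[OF F(2)] by blast
  qed
  show ?thesis
  proof (rule inj_onI, rule ccontr)
    fix a b assume ab: "a \<in> Field \<mu>" "b \<in> Field \<mu>" "x a = x b" "a \<noteq> b"
    then have "(a, b) \<in> \<mu> \<or> (b, a) \<in> \<mu>"
      using wo unfolding order_on_defs total_on_def by blast
    then show False using *[of a b] *[of b a] ab by auto
  qed
qed

lemma free_sequence_imp_free_set:
  fixes \<mu> :: "'i rel"
  assumes "free_sequence Y \<mu> x"
  shows "free_set Y (x ` Field \<mu>)"
proof -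
  have inj: "inj_on x (Field \<mu>)" using free_sequence_inj[OF assms] .
  have wo: "Well_order \<mu>" and sub: "x ` Field \<mu> \<subseteq> topspace Y"
    and disj: "\<And>\<beta>. \<beta> \<in> Field \<mu> \<Longrightarrow>
      (Y closure_of (x ` underS \<mu> \<beta>)) \<inter> (Y closure_of (x ` above \<mu> \<beta>)) = {}"
    using assms unfolding free_sequence_def by auto
  let ?\<nu> = "dir_image \<mu> x"
  have F: "Field ?\<nu> = x ` Field \<mu>" by (rule dir_image_Field)
  have mem: "(x a, x b) \<in> ?\<nu> \<longleftrightarrow> (a, b) \<in> \<mu>" if "a \<in> Field \<mu>" "b \<in> Field \<mu>" for a b
  proof
    assume "(x a, x b) \<in> ?\<nu>"
    then obtain c d where cd: "x a = x c" "x b = x d" "(c, d) \<in> \<mu>"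
      unfolding dir_image_def by blast
    then have "c \<in> Field \<mu>" "d \<in> Field \<mu>" by (auto simp: Field_def)
    then have "a = c" "b = d" using cd inj that by (auto dest: inj_onD)
    then show "(a, b) \<in> \<mu>" using cd by simp
  qed (auto simp: dir_image_def)
  have sets: "underS ?\<nu> (x b) = x ` underS \<mu> b" "above ?\<nu> (x b) = x ` above \<mu> b"
    if b: "b \<in> Field \<mu>" for b
  proof -
    have ex: "\<exists>a\<in>Field \<mu>. y = x a" if "(y, x b) \<in> ?\<nu> \<or> (x b, y) \<in> ?\<nu>" for y
    proof -
      have "y \<in> Field ?\<nu>" using that unfolding Field_def by blast
      then show ?thesis unfolding F by blast
    qed
    show "underS ?\<nu> (x b) = x ` underS \<mu> b"
    proof (intro equalityI subsetI)
      fix y assume y: "y \<in> underS ?\<nu> (x b)"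
      then obtain a where a: "a \<in> Field \<mu>" "y = x a"
        using ex unfolding underS_def by blast
      then have "a \<in> underS \<mu> b" using y mem[OF a(1) b] unfolding underS_def by auto
      then show "y \<in> x ` underS \<mu> b" using a by blast
    next
      fix y assume "y \<in> x ` underS \<mu> b"
      then obtain a where a: "a \<noteq> b" "(a, b) \<in> \<mu>" "y = x a" unfolding underS_def by blast
      then have "a \<in> Field \<mu>" by (auto simp: Field_def)
      then show "y \<in> underS ?\<nu> (x b)"
        using a b inj mem unfolding underS_def by (auto dest: inj_onD)
    qed
    show "above ?\<nu> (x b) = x ` above \<mu> b"
    proof (intro equalityI subsetI)
      fix y assume y: "y \<in> above ?\<nu> (x b)"
      then obtain a where a: "a \<in> Field \<mu>" "y = x a"
        using ex unfolding above_def by blast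
      then have "a \<in> above \<mu> b" using y mem[OF b a(1)] unfolding above_def by auto
      then show "y \<in> x ` above \<mu> b" using a by blast
    next
      fix y assume "y \<in> x ` above \<mu> b"
      then obtain a where a: "(b, a) \<in> \<mu>" "y = x a" unfolding above_def by blast
      then have "a \<in> Field \<mu>" by (auto simp: Field_def)
      then show "y \<in> above ?\<nu> (x b)" using a b mem unfolding above_def by auto
    qed
  qed
  have "free_sequence Y ?\<nu> id"
    unfolding free_sequence_def
    using Well_order_dir_image[OF wo inj] sub disj sets by (auto simp: F)
  then show ?thesis unfolding free_set_def using F by (metis image_id id_apply)
qed

lemma free_set_subset: "free_set Y S \<Longrightarrow> S \<subseteq> topspace Y"
  unfolding free_set_def free_sequence_def by blast

lemma free_set_card: "free_set Y S \<Longrightarrow> |S| \<le>o |topspace Y|"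
  by (simp add: free_set_subset card_of_mono1)

lemma free_number:
  shows "Card_order (free_number Y)"
    and "\<forall>S. free_set Y S \<longrightarrow> |S| \<le>o free_number Y"
  by (rule least_cardinal(1,2)[OF free_number_def[of Y] card_of_Card_order[of "topspace Y"]]; simp add: free_set_card)+

lemma free_number_least:
  fixes k :: "'k rel"
  assumes "Card_order k" and "\<And>S. free_set Y S \<Longrightarrow> |S| \<le>o k"
  shows "free_number Y \<le>o k"
  by (rule least_cardinal_le[OF free_number_def[of Y] card_of_Card_order[of "topspace Y"]])
     (use assms in \<open>simp_all add: free_set_card ordLeq_cong_right\<close>)

lemma free_lindelof_number_bound:
  "lindelof_number (subtopology Y (Y closure_of S)) \<le>o |topspace Y|"
  using lindelof_number_le_card
  by (rule ordLeq_transitive) (simp add: card_of_mono1)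

lemma free_lindelof_number:
  shows "Card_order (free_lindelof_number Y)"
    and "\<forall>S. free_set Y S \<longrightarrow>
           lindelof_number (subtopology Y (Y closure_of S)) \<le>o free_lindelof_number Y"
  by (rule least_cardinal(1,2)[OF free_lindelof_number_def[of Y] card_of_Card_order[of "topspace Y"]]; simp add: free_lindelof_number_bound)+

lemma free_lindelof_number_least:
  fixes k :: "'k rel"
  assumes "Card_order k"
    and "\<And>S. free_set Y S \<Longrightarrow> lindelof_number (subtopology Y (Y closure_of S)) \<le>o k"
  shows "free_lindelof_number Y \<le>o k"
  by (rule least_cardinal_le[OF free_lindelof_number_def[of Y] card_of_Card_order[of "topspace Y"]])
     (use assms in \<open>simp_all add: free_lindelof_number_bound ordLeq_cong_right\<close>)

lemma pseudocharacter_family: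
  assumes "Hausdorff_space Y" "x \<in> topspace Y"
  shows "\<exists>\<U>. (\<forall>U\<in>\<U>. openin Y U) \<and> topspace Y \<inter> \<Inter>\<U> = {x} \<and> |\<U>| \<le>o |topspace Y|"
proof (intro exI conjI)
  let ?\<U> = "(\<lambda>y. topspace Y - {y}) ` (topspace Y - {x})"
  have "closedin Y {y}" if "y \<in> topspace Y" for y
    using assms that by (simp add: closedin_Hausdorff_singleton)
  then show "\<forall>U\<in>?\<U>. openin Y U" by (auto intro: openin_diff)
  show "topspace Y \<inter> \<Inter>?\<U> = {x}" using assms(2) by auto
  show "|?\<U>| \<le>o |topspace Y|"
    by (rule ordLeq_transitive[OF card_of_image card_of_mono1]) blast
qed

lemma pseudocharacter_at_exists:
  fixes Y :: "'a topology"
  assumes "Hausdorff_space Y" "x \<in> topspace Y"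
  shows "\<exists>r :: 'a rel. Card_order r \<and> r \<le>o |topspace Y| \<and>
     (\<exists>\<U>. (\<forall>U\<in>\<U>. openin Y U) \<and> topspace Y \<inter> \<Inter>\<U> = {x :: 'a} \<and> |\<U>| =o r)"
proof -
  obtain \<U> where U: "\<forall>U\<in>\<U>. openin Y U" "topspace Y \<inter> \<Inter>\<U> = {x}" "|\<U>| \<le>o |topspace Y|"
    using pseudocharacter_family[OF assms] by blast
  then obtain B :: "'a set" where "|\<U>| =o |B|" "|B| \<le>o |topspace Y|"
    using internalize_card_of_ordLeq2[of \<U> "topspace Y"] by blast
  with U show ?thesis by (intro exI[of _ "|B|"]) (auto simp: card_of_Card_order)
qed

lemma pseudocharacter_at:
  fixes Y :: "'a topology"
  assumes "Hausdorff_space Y" "x \<in> topspace Y"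
  shows "Card_order (pseudocharacter_at Y x)"
    and "\<exists>\<U>. (\<forall>U\<in>\<U>. openin Y U) \<and> topspace Y \<inter> \<Inter>\<U> = {x} \<and> |\<U>| =o pseudocharacter_at Y x"
proof -
  obtain r :: "'a rel" where "Card_order r"
    "\<exists>\<U>. (\<forall>U\<in>\<U>. openin Y U) \<and> topspace Y \<inter> \<Inter>\<U> = {x} \<and> |\<U>| =o r"
    using pseudocharacter_at_exists[OF assms] by (elim exE conjE) blast
  note * = least_cardinal(1,2)[OF pseudocharacter_at_def this]
  show "Card_order (pseudocharacter_at Y x)"
    "\<exists>\<U>. (\<forall>U\<in>\<U>. openin Y U) \<and> topspace Y \<inter> \<Inter>\<U> = {x} \<and> |\<U>| =o pseudocharacter_at Y x"
    by (rule *)+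
qed

lemma pseudocharacter_at_least:
  fixes Y :: "'a topology"
  assumes "Hausdorff_space Y" "x \<in> topspace Y"
    and "\<forall>U\<in>\<U>. openin Y U" "topspace Y \<inter> \<Inter>\<U> = {x}"
  shows "pseudocharacter_at Y x \<le>o |\<U>|"
proof -
  obtain r :: "'a rel" where "Card_order r"
    "\<exists>\<U>. (\<forall>U\<in>\<U>. openin Y U) \<and> topspace Y \<inter> \<Inter>\<U> = {x} \<and> |\<U>| =o r"
    using pseudocharacter_at_exists[OF assms(1,2)] by (elim exE conjE) blast
  note r = this
  show ?thesis
  proof (rule least_cardinal_le[OF pseudocharacter_at_def r card_of_Card_order])
    fix t :: "'a rel" assume "t =o |\<U>|"
    then have "|\<U>| =o t" by (rule ordIso_symmetric)
    then show "\<exists>\<U>. (\<forall>U\<in>\<U>. openin Y U) \<and> topspace Y \<inter> \<Inter>\<U> = {x} \<and> |\<U>| =o t"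
      using assms(3,4) by (intro exI[of _ \<U>] conjI)
  qed
qed

lemma pseudocharacter_at_bound:
  assumes "Hausdorff_space Y" "x \<in> topspace Y"
  shows "pseudocharacter_at Y x \<le>o |topspace Y|"
proof -
  obtain \<U> where U: "\<forall>U\<in>\<U>. openin Y U" "topspace Y \<inter> \<Inter>\<U> = {x}" "|\<U>| \<le>o |topspace Y|"
    using pseudocharacter_family[OF assms] by blast
  show ?thesis using pseudocharacter_at_least[OF assms U(1,2)] U(3) by (rule ordLeq_transitive)
qed

lemma pseudocharacter:
  assumes "Hausdorff_space Y"
  shows "Card_order (pseudocharacter Y)"
    and "\<forall>x\<in>topspace Y. pseudocharacter_at Y x \<le>o pseudocharacter Y"
  by (rule least_cardinal(1,2)[OF pseudocharacter_def[of Y] card_of_Card_order[of "topspace Y"]]; use assms in \<open>simp add: pseudocharacter_at_bound\<close>)+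

lemma pseudocharacter_least:
  fixes k :: "'k rel"
  assumes "Hausdorff_space Y" "Card_order k"
    and "\<And>x. x \<in> topspace Y \<Longrightarrow> pseudocharacter_at Y x \<le>o k"
  shows "pseudocharacter Y \<le>o k"
  by (rule least_cardinal_le[OF pseudocharacter_def[of Y] card_of_Card_order[of "topspace Y"]])
     (use assms in \<open>simp_all add: pseudocharacter_at_bound ordLeq_cong_right\<close>)

end

theory Submission
  imports Defs
begin

text \<open>
  For infinite \<open>\<kappa>\<close>, call a subspace good if its Lindelof number, its \<open>F\<close> and its \<open>\<psi>\<close> are at most \<open>\<kappa>\<close>.
  A transfinite construction of length \<open>\<kappa>\<^sup>+\<close> shows \<open>L \<le> FL \<cdot> F\<close>, so every \<open>X\<^sub>\<alpha>\<close> is good.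
  The core is the bound \<open>|X| \<le> 2\<^sup>\<kappa>\<close> for every Hausdorff space in which each subset of size at most
  \<open>2\<^sup>\<kappa>\<close> lies in a good subspace. With the space itself as good subspace it gives \<open>|X\<^sub>\<alpha>| \<le> 2\<^sup>\<kappa>\<close>;
  if then \<open>|X| > 2\<^sup>\<kappa>\<close>, no \<open>2\<^sup>\<kappa>\<close> of the \<open>X\<^sub>\<alpha>\<close> cover \<open>X\<close>, so every subset of size at most \<open>2\<^sup>\<kappa>\<close> lies in a
  single \<open>X\<^sub>\<alpha>\<close>, and the bound applies to \<open>X\<close> itself, a contradiction.

  For the core one shows in turn that \<open>F(X) \<le> \<kappa>\<close>, that closures of sets of size at most \<open>\<kappa>\<close> have
  at most \<open>2\<^sup>\<kappa>\<close> points (hence lie in a good subspace and are \<open>\<kappa>\<close>-Lindelof), and that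
  \<open>\<psi>(X) \<le> \<kappa>\<close>. A closing-off argument produces \<open>H\<close> of size at most \<open>2\<^sup>\<kappa>\<close> closed under closures of sets of size
  at most \<open>\<kappa>\<close> and meeting the complement of every union of at most \<open>\<kappa>\<close> chosen neighbourhoods of its points
  that is not everything. For a point \<open>p\<close> outside \<open>H\<close>, the neighbourhoods missing \<open>p\<close> cover \<open>H\<close>, and a
  free sequence argument extracts \<open>\<kappa>\<close> many that still cover \<open>H\<close>, contradicting the choice of \<open>H\<close>.
\<close>

section \<open>Cardinals and transfinite constructions\<close>

lemma Cinfinite_two_power: "Cinfinite \<kappa> \<Longrightarrow> Cinfinite (ctwo ^c \<kappa>)"
  by (rule Cinfinite_cexp[OF ordLeq_refl[OF Card_order_ctwo]])

lemma le_two_power: "Card_order \<kappa> \<Longrightarrow> \<kappa> \<le>o ctwo ^c \<kappa>"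
  by (rule ordLess_imp_ordLeq[OF ordLess_ctwo_cexp])

lemma card_le_iff_card_Field: "Card_order \<kappa> \<Longrightarrow> |A| \<le>o \<kappa> \<longleftrightarrow> |A| \<le>o |Field \<kappa>|"
  by (rule ordLeq_cong_right[OF ordIso_symmetric[OF card_of_Field_ordIso]])

lemma card_singleton_le:
  assumes "Cinfinite \<kappa>"
  shows "|{a}| \<le>o \<kappa>"
proof -
  have "Field \<kappa> \<noteq> {}" using assms unfolding cinfinite_def by auto
  then have "|{a}| \<le>o |Field \<kappa>|" by (rule card_of_singl_ordLeq)
  then show ?thesis using assms card_le_iff_card_Field by blast
qed

lemma card_less_cardSuc:
  assumes "Card_order \<kappa>"
  shows "|A| <o cardSuc \<kappa> \<longleftrightarrow> |A| \<le>o \<kappa>"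
  by (rule cardSuc_ordLeq_ordLess[OF assms card_of_Card_order])

lemma card_under_cardSuc:
  assumes "Cinfinite \<kappa>" "\<beta> \<in> Field (cardSuc \<kappa>)"
  shows "|underS (cardSuc \<kappa>) \<beta>| \<le>o \<kappa>" and "|under (cardSuc \<kappa>) \<beta>| \<le>o \<kappa>"
proof -
  have co: "Card_order (cardSuc \<kappa>)"
    using assms(1) by (simp add: cardSuc_Card_order)
  show *: "|underS (cardSuc \<kappa>) \<beta>| \<le>o \<kappa>"
    using card_of_underS[OF co assms(2)] assms(1) by (simp add: card_less_cardSuc)
  have "Refl (cardSuc \<kappa>)"
    using co unfolding card_order_on_def order_on_defs by blast
  then have "under (cardSuc \<kappa>) \<beta> = underS (cardSuc \<kappa>) \<beta> \<union> {\<beta>}"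
    using assms(2) by (rule Refl_under_underS)
  moreover have "|{\<beta>}| \<le>o \<kappa>" using card_singleton_le[OF assms(1)] .
  ultimately show "|under (cardSuc \<kappa>) \<beta>| \<le>o \<kappa>"
    using * assms(1) by (simp only: Un_Cinfinite_bound)
qed

text \<open>A nonempty \<open>S\<close> of size at most \<kappa> is the image of a function from
  \<open>Field \<kappa>\<close> to \<open>H\<close>, and there are at most
  \<open>(2\<^sup>\<kappa>)\<^sup>\<kappa> = 2\<^sup>\<kappa>\<close> such functions.\<close>

lemma card_subsets_bound:
  assumes "Cinfinite \<kappa>" "|H| \<le>o ctwo ^c \<kappa>"
  shows "|{S. S \<subseteq> H \<and> |S| \<le>o \<kappa>}| \<le>o ctwo ^c \<kappa>"
proof -
  have "{S. S \<subseteq> H \<and> |S| \<le>o \<kappa>} \<subseteq> {{}} \<union> (\<lambda>f. f ` Field \<kappa>) ` Func (Field \<kappa>) H"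
  proof (intro subsetI)
    fix S assume S: "S \<in> {S. S \<subseteq> H \<and> |S| \<le>o \<kappa>}"
    show "S \<in> {{}} \<union> (\<lambda>f. f ` Field \<kappa>) ` Func (Field \<kappa>) H"
    proof (cases "S = {}")
      case False
      have "|S| \<le>o |Field \<kappa>|"
        using S assms(1) by (simp add: card_le_iff_card_Field)
      then have "\<exists>g. g ` Field \<kappa> = S" by (rule iffD2[OF card_of_ordLeq2[OF False]])
      then obtain g where g: "g ` Field \<kappa> = S" by blast
      define f where "f = (\<lambda>a. if a \<in> Field \<kappa> then g a else undefined)"
      have "f \<in> Func (Field \<kappa>) H" "f ` Field \<kappa> = S"
        using S g unfolding Func_def f_def by auto
      then show ?thesis by blast
    qed simp
  qed
  then have le: "|{S. S \<subseteq> H \<and> |S| \<le>o \<kappa>}| \<le>o |{{}} \<union> (\<lambda>f. f ` Field \<kappa>) ` Func (Field \<kappa>) H|"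
    by (rule card_of_mono1)
  have c: "Cinfinite (ctwo ^c \<kappa>)"
    using assms(1) by (rule Cinfinite_two_power)
  moreover have "|(\<lambda>f. f ` Field \<kappa>) ` Func (Field \<kappa>) H| \<le>o ctwo ^c \<kappa>"
  proof -
    have "|(\<lambda>f. f ` Field \<kappa>) ` Func (Field \<kappa>) H| \<le>o |H| ^c \<kappa>"
      unfolding cexp_def Field_card_of by (rule card_of_image)
    also have "|H| ^c \<kappa> \<le>o (ctwo ^c \<kappa>) ^c \<kappa>"
      using assms by (intro cexp_mono1) simp_all
    also have "(ctwo ^c \<kappa>) ^c \<kappa> =o ctwo ^c \<kappa>"
      using assms(1) by (intro cexp_cprod_ordLeq)
        (simp_all add: Card_order_ctwo Cinfinite_Cnotzero ordLeq_refl)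
    finally show ?thesis .
  qed
  moreover have "|{{}}| \<le>o ctwo ^c \<kappa>" using card_singleton_le[OF c] .
  ultimately have "|{{}} \<union> (\<lambda>f. f ` Field \<kappa>) ` Func (Field \<kappa>) H| \<le>o ctwo ^c \<kappa>"
    using c by (intro Un_Cinfinite_bound)
  with le show ?thesis by (rule ordLeq_transitive)
qed

lemma card_Field_cardSuc_le:
  assumes "Card_order \<kappa>"
  shows "|Field (cardSuc \<kappa>)| \<le>o ctwo ^c \<kappa>"
proof (rule ordIso_ordLeq_trans[OF card_of_Field_ordIso])
  show "Card_order (cardSuc \<kappa>)" using assms by (rule cardSuc_Card_order)
  show "cardSuc \<kappa> \<le>o ctwo ^c \<kappa>"
    using assms by (intro cardSuc_least Card_order_cexp ordLess_ctwo_cexp)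
qed

lemma not_card_Field_cardSuc_le: "\<not> |Field (cardSuc \<kappa>)| \<le>o \<kappa>" if "Card_order \<kappa>"
proof
  assume *: "|Field (cardSuc \<kappa>)| \<le>o \<kappa>"
  have "cardSuc \<kappa> =o |Field (cardSuc \<kappa>)|"
    by (rule ordIso_symmetric[OF card_of_Field_ordIso[OF cardSuc_Card_order[OF that]]])
  from ordIso_ordLeq_trans[OF this *] have "cardSuc \<kappa> \<le>o \<kappa>" .
  then show False using cardSuc_greater[OF that] not_ordLess_ordLeq by blast
qed

lemma card_le_if_inj_image:
  assumes "inj_on f C" "|f ` C| \<le>o \<kappa>"
  shows "|C| \<le>o \<kappa>"
  using card_of_ordIsoI[OF inj_on_imp_bij_betw[OF assms(1)]] assms(2)
  by (rule ordIso_ordLeq_trans)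

lemma card_le_image:
  assumes "|C| \<le>o \<kappa>"
  shows "|f ` C| \<le>o \<kappa>"
  using card_of_image assms by (rule ordLeq_transitive)

text \<open>Choosing one index per member keeps the index set small. This turns a small subcover of
  an indexed cover into a small set of indices.\<close>

lemma subset_image_card:
  assumes "\<V> \<subseteq> f ` T" "|\<V>| \<le>o \<kappa>"
  shows "\<exists>C\<subseteq>T. \<V> = f ` C \<and> |C| \<le>o \<kappa>"
  using assms card_le_if_inj_image[of f _ \<kappa>] unfolding subset_image_inj by blast

lemma card_Pow_le:
  assumes "Card_order \<kappa>" "|A| \<le>o \<kappa>"
  shows "|Pow A| \<le>o ctwo ^c \<kappa>"
proof -
  have "|A| \<le>o |Field \<kappa>|" using assms by (simp add: card_le_iff_card_Field)
  then obtain f where f: "inj_on f A" "f ` A \<subseteq> Field \<kappa>" unfolding card_of_ordLeq[symmetric] by blast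
  have "inj_on (image f) (Pow A)" using f(1) by (rule inj_on_image_Pow)
  moreover have "image f ` Pow A \<subseteq> Pow (Field \<kappa>)" using f(2) by blast
  ultimately have "|Pow A| \<le>o |Pow (Field \<kappa>)|" by (rule card_of_ordLeqI[OF _ subsetD[OF _ imageI]])
  also have "|Pow (Field \<kappa>)| =o ctwo ^c \<kappa>"
    unfolding ctwo_def cexp_def Field_card_of by (rule card_of_Pow_Func)
  finally show ?thesis .
qed

lemma Cnotzero_card_of: "A \<noteq> {} \<Longrightarrow> Cnotzero |A|"
  by (simp add: card_of_ordIso_czero_iff_empty card_of_Card_order)

lemma ordLeq_cprod1: "\<lbrakk>Card_order p1; Cnotzero p2\<rbrakk> \<Longrightarrow> p1 \<le>o p1 *c p2"
  by (rule ordLeq_ordIso_trans[OF ordLeq_cprod2 cprod_com])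

lemma Cnotzero_cprod: "\<lbrakk>Cnotzero p1; Cnotzero p2\<rbrakk> \<Longrightarrow> Cnotzero (p1 *c p2)"
  by (rule Cnotzero_mono[OF _ Card_order_cprod ordLeq_cprod1]) simp_all

text \<open>Stage \<open>h \<beta>\<close> of a recursion along \<open>\<kappa>\<^sup>+\<close>
  collects the earlier stages and the values \<open>F S\<close> on their small subsets. Regularity
  of \<open>\<kappa>\<^sup>+\<close> puts every small subset of the union into one stage, and
  \<open>\<kappa>\<^sup>+ \<le> 2\<^sup>\<kappa>\<close> keeps the sizes down.\<close>

lemma closing_off:
  fixes \<kappa> :: "'k rel" and F :: "'a set \<Rightarrow> 'a set"
  assumes \<kappa>: "Cinfinite \<kappa>"
    and F: "\<And>S. S \<subseteq> T \<Longrightarrow> |S| \<le>o \<kappa> \<Longrightarrow> F S \<subseteq> T \<and> |F S| \<le>o ctwo ^c \<kappa>"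
  shows "\<exists>H\<subseteq>T. |H| \<le>o ctwo ^c \<kappa> \<and> (\<forall>S\<subseteq>H. |S| \<le>o \<kappa> \<longrightarrow> F S \<subseteq> H)"
proof -
  let ?r = "cardSuc \<kappa>"
  let ?c = "ctwo ^c \<kappa>"
  let ?G = "\<lambda>h \<beta>. \<Union>\<gamma>\<in>underS ?r \<beta>. h \<gamma> \<union> (\<Union>S\<in>{S. S \<subseteq> h \<gamma> \<and> |S| \<le>o \<kappa>}. F S)"
  have co: "Card_order ?r" using \<kappa> by (simp add: cardSuc_Card_order)
  then have wo: "Well_order ?r" by (simp add: card_order_on_def)
  have wf: "wf (?r - Id)" using wo by (simp add: well_order_on_def)
  have c: "Cinfinite ?c"
    using \<kappa> by (rule Cinfinite_two_power)
  \<comment> \<open>The admissible value is unique, so \<open>dependent_wf_choice\<close> acts as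
    plain recursion.\<close>
  have "\<exists>h. \<forall>\<beta>. h \<beta> = ?G h \<beta>"
  proof (rule dependent_wf_choice[OF wf])
    fix f g :: "'k set \<Rightarrow> 'a set" and \<beta> y
    assume fg: "\<And>\<gamma>. (\<gamma>, \<beta>) \<in> ?r - Id \<Longrightarrow> f \<gamma> = g \<gamma>"
    have "?G f \<beta> = ?G g \<beta>"
      by (intro SUP_cong refl) (simp add: fg underS_def)
    then show "(y = ?G f \<beta>) = (y = ?G g \<beta>)" by simp
  qed blast
  then obtain h where h: "\<And>\<beta>. h \<beta> = ?G h \<beta>" by blast
  have rc: "|Field ?r| \<le>o ?c"
    using card_Field_cardSuc_le \<kappa> by blast
  have bound: "h \<beta> \<subseteq> T \<and> |h \<beta>| \<le>o ?c" for \<beta>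
  proof (induction \<beta> rule: wf_induct_rule[OF wf])
    case (1 \<beta>)
    have IH: "h \<gamma> \<subseteq> T" "|h \<gamma>| \<le>o ?c" if "\<gamma> \<in> underS ?r \<beta>" for \<gamma>
      using 1[of \<gamma>] that unfolding underS_def by auto
    have "?G h \<beta> \<subseteq> T" using IH(1) F by blast
    moreover have "|?G h \<beta>| \<le>o ?c"
    proof (intro UNION_Cinfinite_bound ballI Un_Cinfinite_bound c)
      show "|underS ?r \<beta>| \<le>o ?c"
        using card_of_mono1[OF Order_Relation.underS_Field] rc by (rule ordLeq_transitive)
      fix \<gamma> assume g: "\<gamma> \<in> underS ?r \<beta>"
      show "|h \<gamma>| \<le>o ?c" using IH(2)[OF g] .
      then show "|{S. S \<subseteq> h \<gamma> \<and> |S| \<le>o \<kappa>}| \<le>o ?c" by (rule card_subsets_bound[OF \<kappa>])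
      fix S assume "S \<in> {S. S \<subseteq> h \<gamma> \<and> |S| \<le>o \<kappa>}"
      then show "|F S| \<le>o ?c" using F IH(1)[OF g] by blast
    qed
    ultimately show ?case unfolding h[of \<beta>] by blast
  qed
  have chain: "relChain ?r h"
    unfolding relChain_def
  proof (intro allI impI)
    fix i j assume "(i, j) \<in> ?r"
    then show "h i \<subseteq> h j"
      by (cases "i = j") (auto simp: underS_def h[of j])
  qed
  show ?thesis
  proof (intro exI conjI allI impI)
    show "(\<Union>\<beta>\<in>Field ?r. h \<beta>) \<subseteq> T" using bound by blast
    show "|\<Union>\<beta>\<in>Field ?r. h \<beta>| \<le>o ?c"
      using bound by (intro UNION_Cinfinite_bound rc ballI c) blast
    fix S assume S: "S \<subseteq> (\<Union>\<beta>\<in>Field ?r. h \<beta>)" "|S| \<le>o \<kappa>"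
    then obtain i where i: "i \<in> Field ?r" "S \<subseteq> h i"
      using cardSuc_UNION_Cinfinite[OF \<kappa> chain] by blast
    \<comment> \<open>\<open>h i\<close> need not contain \<open>F S\<close>, which is only added at
      strictly later stages; \<open>\<kappa>\<^sup>+\<close> has no last element.\<close>
    have "\<exists>j\<in>Field ?r. i \<noteq> j \<and> (i, j) \<in> ?r"
      using infinite_Card_order_limit[OF co _ i(1)] \<kappa> Cinfinite_cardSuc[OF \<kappa>]
      unfolding cinfinite_def by blast
    then obtain j where j: "j \<in> Field ?r" "i \<in> underS ?r j" by (auto simp: underS_def)
    then have "F S \<subseteq> h j" using S(2) i(2) by (subst h) blast
    then show "F S \<subseteq> (\<Union>\<beta>\<in>Field ?r. h \<beta>)" using j(1) by blast
  qed
qed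

text \<open>The common recursion behind both free sequence arguments, with \<open>Q y W\<close> read
  as \<open>y \<notin> W\<close> for covers and as \<open>y \<in> W\<close> for pseudocharacter. At
  each stage at most \<kappa> sets are attached to the initial segments so far, so the hypothesis
  supplies a next point.\<close>

lemma long_sequence:
  fixes \<kappa> :: "'k rel" and \<W> :: "'a set \<Rightarrow> 'b set"
  assumes \<kappa>: "Cinfinite \<kappa>" and W: "\<And>A. |\<W> A| \<le>o \<kappa>"
    and Q: "\<And>\<V>. \<V> \<subseteq> \<Union>(range \<W>) \<Longrightarrow> |\<V>| \<le>o \<kappa> \<Longrightarrow> \<exists>y\<in>T. \<forall>W\<in>\<V>. Q y W"
  shows "\<exists>x. (\<forall>\<beta>\<in>Field (cardSuc \<kappa>). x \<beta> \<in> T) \<and>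
    (\<forall>\<beta> \<gamma>. (\<gamma>, \<beta>) \<in> cardSuc \<kappa> \<longrightarrow> (\<forall>W\<in>\<W> (x ` underS (cardSuc \<kappa>) \<gamma>). Q (x \<beta>) W))"
proof -
  let ?r = "cardSuc \<kappa>"
  \<comment> \<open>\<open>under\<close> includes \<gamma> = \<beta>, so \<open>x \<beta>\<close>
    already respects the sets attached to \<open>underS ?r \<beta>\<close>: the final segment of a
    free sequence starts at \<beta> itself. Still only values below \<beta> are consulted.\<close>
  let ?V = "\<lambda>x \<beta>. \<Union>\<gamma>\<in>under ?r \<beta>. \<W> (x ` underS ?r \<gamma>)"
  let ?P = "\<lambda>x \<beta> y. \<beta> \<in> Field ?r \<longrightarrow> y \<in> T \<and> (\<forall>W\<in>?V x \<beta>. Q y W)"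
  have co: "Card_order ?r" using \<kappa> by (simp add: cardSuc_Card_order)
  then have wo: "Well_order ?r" by (simp add: card_order_on_def)
  have wf: "wf (?r - Id)" using wo by (simp add: well_order_on_def)
  have "\<exists>x. \<forall>\<beta>. ?P x \<beta> (x \<beta>)"
  proof (rule dependent_wf_choice[OF wf])
    fix f g :: "'k set \<Rightarrow> 'a" and \<beta> y
    assume fg: "\<And>\<gamma>. (\<gamma>, \<beta>) \<in> ?r - Id \<Longrightarrow> f \<gamma> = g \<gamma>"
    have "f ` underS ?r \<gamma> = g ` underS ?r \<gamma>" if "\<gamma> \<in> under ?r \<beta>" for \<gamma>
    proof (rule image_cong[OF refl])
      fix \<delta> assume "\<delta> \<in> underS ?r \<gamma>"
      then have "(\<delta>, \<beta>) \<in> ?r - Id"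
        using that wo unfolding underS_def under_def order_on_defs
        by (auto dest: transD antisymD)
      then show "f \<delta> = g \<delta>" by (rule fg)
    qed
    then show "?P f \<beta> y = ?P g \<beta> y" by simp
  next
    fix x \<beta>
    show "\<exists>y. ?P x \<beta> y"
    proof (cases "\<beta> \<in> Field ?r")
      case True
      have "|?V x \<beta>| \<le>o \<kappa>"
        using W by (intro UNION_Cinfinite_bound card_under_cardSuc \<kappa> True) blast
      then show ?thesis using Q[of "?V x \<beta>"] by blast
    qed blast
  qed
  then obtain x where x: "\<And>\<beta>. ?P x \<beta> (x \<beta>)" by blast
  show ?thesis
  proof (intro exI conjI ballI allI impI)
    fix \<beta> assume "\<beta> \<in> Field ?r" then show "x \<beta> \<in> T" using x by blast
  next
    fix \<beta> \<gamma> W assume *: "(\<gamma>, \<beta>) \<in> ?r" "W \<in> \<W> (x ` underS ?r \<gamma>)"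
    then have "\<beta> \<in> Field ?r" "\<gamma> \<in> under ?r \<beta>" by (auto simp: Field_def under_def)
    then show "Q (x \<beta>) W" using x * by blast
  qed
qed

section \<open>Free sequences and covers\<close>

lemma free_sequence_Restr:
  fixes \<mu> :: "'i rel"
  assumes "free_sequence Y \<mu> x" "J \<subseteq> Field \<mu>"
  shows "free_sequence Y (Restr \<mu> J) x" and "Field (Restr \<mu> J) = J"
proof -
  have wo: "Well_order \<mu>" using assms(1) by (simp add: free_sequence_def)
  show F: "Field (Restr \<mu> J) = J"
    using wo assms(2) by (intro Refl_Field_Restr2) (simp_all add: order_on_defs)
  have "(Y closure_of (x ` underS (Restr \<mu> J) \<beta>)) \<inter> (Y closure_of (x ` above (Restr \<mu> J) \<beta>)) = {}"
    if "\<beta> \<in> J" for \<beta>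
  proof -
    have "Y closure_of (x ` underS (Restr \<mu> J) \<beta>) \<subseteq> Y closure_of (x ` underS \<mu> \<beta>)"
      "Y closure_of (x ` above (Restr \<mu> J) \<beta>) \<subseteq> Y closure_of (x ` above \<mu> \<beta>)"
      by (intro closure_of_mono image_mono; auto simp: underS_def above_def)+
    then show ?thesis using assms that unfolding free_sequence_def by blast
  qed
  then show "free_sequence Y (Restr \<mu> J) x"
    using assms Well_order_Restr[OF wo, of J] unfolding free_sequence_def F by blast
qed

lemma free_set_mono:
  assumes "free_set Y S" "B \<subseteq> S"
  shows "free_set Y B"
proof -
  from assms(1) obtain \<mu> :: "'a rel" and x where
    \<mu>: "free_sequence Y \<mu> x" "S = x ` Field \<mu>" unfolding free_set_def by blast
  then obtain J where J: "J \<subseteq> Field \<mu>" "B = x ` J" using assms(2) by (metis subset_image_iff)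
  show ?thesis
    using free_sequence_imp_free_set[OF free_sequence_Restr(1)[OF \<mu>(1) J(1)]]
      free_sequence_Restr(2)[OF \<mu>(1) J(1)] J(2) by simp
qed

text \<open>Closures in a subspace are traces of closures in \<open>X\<close>, so disjointness
  passes down; it need not pass up.\<close>

lemma free_set_subtopology:
  assumes "free_set X S" "S \<subseteq> Y"
  shows "free_set (subtopology X Y) S"
proof -
  from assms(1) obtain \<mu> :: "'a rel" and x where
    \<mu>: "free_sequence X \<mu> x" "S = x ` Field \<mu>" unfolding free_set_def by blast
  have "x ` underS \<mu> \<beta> \<subseteq> Y" "x ` above \<mu> \<beta> \<subseteq> Y" for \<beta>
    using assms(2) \<mu>(2) by (auto simp: underS_def above_def Field_def)
  then have "free_sequence (subtopology X Y) \<mu> x"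
    using \<mu> assms(2) unfolding free_sequence_def
    by (simp add: closure_of_subtopology Int_absorb1) blast
  then show ?thesis using \<mu>(2) unfolding free_set_def by blast
qed

text \<open>Any well-order of \<open>B\<close> works, since finite sets are closed. This makes
  \<open>F\<close> and \<open>FL\<close> nonzero on nonempty spaces and settles the case of finite
  \<kappa>.\<close>

lemma free_set_finite:
  assumes "t1_space Y" "finite B" "B \<subseteq> topspace Y"
  shows "free_set Y B"
proof -
  obtain r where r: "well_order_on B r" using well_order_on by blast
  then have wo: "Well_order r" and F: "Field r = B"
    using well_order_on_Well_order by blast+
  have cl: "Y closure_of C = C" if "C \<subseteq> B" for C
    using that assms finite_subset[OF that] t1_space_closedin_finite[of Y]
    by (metis closure_of_closedin order_trans)
  have "underS r \<beta> \<inter> above r \<beta> = {}" for \<beta>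
    using wo unfolding underS_def above_def order_on_defs by (auto dest: antisymD)
  moreover have "underS r \<beta> \<subseteq> B" "above r \<beta> \<subseteq> B" for \<beta>
    using F by (auto simp: underS_def above_def Field_def)
  ultimately have "free_sequence Y r id"
    using wo F assms(3) unfolding free_sequence_def by (simp add: cl)
  then show ?thesis using F unfolding free_set_def by (metis image_id id_apply)
qed

lemma cover_from_free_sets:
  fixes \<kappa> :: "'k rel" and X :: "'a topology"
  assumes \<kappa>: "Cinfinite \<kappa>"
    and free: "\<And>S. free_set X S \<Longrightarrow> |S| \<le>o \<kappa>"
    and opn: "\<And>U. U \<in> \<U> \<Longrightarrow> openin X U"
    and H: "H \<subseteq> topspace X"
    and cov: "\<And>S. S \<subseteq> H \<Longrightarrow> free_set X S \<Longrightarrow>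
      \<exists>\<V>\<subseteq>\<U>. |\<V>| \<le>o \<kappa> \<and> X closure_of S \<subseteq> \<Union>\<V>"
  shows "\<exists>\<V>\<subseteq>\<U>. |\<V>| \<le>o \<kappa> \<and> H \<subseteq> \<Union>\<V>"
proof (rule ccontr)
  assume no: "\<not> ?thesis"
  let ?r = "cardSuc \<kappa>"
  have wo: "Well_order ?r"
    using \<kappa> cardSuc_Card_order[of \<kappa>] unfolding card_order_on_def by blast
  then have wf: "wf (?r - Id)" by (simp add: well_order_on_def)
  have "\<exists>\<V>\<subseteq>\<U>. |\<V>| \<le>o \<kappa> \<and> (A \<subseteq> H \<and> free_set X A \<longrightarrow> X closure_of A \<subseteq> \<Union>\<V>)" for A
  proof (cases "A \<subseteq> H \<and> free_set X A")
    case True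
    then have "\<exists>\<V>\<subseteq>\<U>. |\<V>| \<le>o \<kappa> \<and> X closure_of A \<subseteq> \<Union>\<V>" by (intro cov) simp_all
    then show ?thesis by blast
  next
    case False
    \<comment> \<open>The empty family is a default value: the recursion needs \<open>\<W>\<close>
      on every set.\<close>
    have "|{} :: 'a set set| \<le>o \<kappa>" using \<kappa> by (simp add: card_of_empty1)
    with False show ?thesis by (intro exI[of _ "{}"] conjI) auto
  qed
  then have "\<forall>A. \<exists>\<V>. \<V> \<subseteq> \<U> \<and> |\<V>| \<le>o \<kappa> \<and> (A \<subseteq> H \<and> free_set X A \<longrightarrow> X closure_of A \<subseteq> \<Union>\<V>)"
    by (rule allI)
  from choice[OF this] obtain \<W> where "\<And>A. \<W> A \<subseteq> \<U> \<and> |\<W> A| \<le>o \<kappa> \<and>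
      (A \<subseteq> H \<and> free_set X A \<longrightarrow> X closure_of A \<subseteq> \<Union>(\<W> A))"
    by (elim exE) (rule that, erule spec)
  then have W: "\<And>A. \<W> A \<subseteq> \<U>" "\<And>A. |\<W> A| \<le>o \<kappa>"
    "\<And>A. A \<subseteq> H \<Longrightarrow> free_set X A \<Longrightarrow> X closure_of A \<subseteq> \<Union>(\<W> A)"
    by simp_all
  have "\<exists>y\<in>H. \<forall>V\<in>\<V>. y \<notin> V" if "\<V> \<subseteq> \<Union>(range \<W>)" "|\<V>| \<le>o \<kappa>" for \<V>
  proof -
    have "\<V> \<subseteq> \<U>" using that(1) W(1) by blast
    then have "\<not> H \<subseteq> \<Union>\<V>" using that(2) no by blast
    then show ?thesis by blast
  qed
  from long_sequence[of \<kappa> \<W> H "\<lambda>y V. y \<notin> V", OF \<kappa> W(2) this]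
  obtain x where x: "\<And>\<beta>. \<beta> \<in> Field ?r \<Longrightarrow> x \<beta> \<in> H"
    "\<And>\<beta> \<gamma>. (\<gamma>, \<beta>) \<in> ?r \<Longrightarrow> x \<beta> \<notin> \<Union>(\<W> (x ` underS ?r \<gamma>))"
    by blast
  \<comment> \<open>\<open>\<W>\<close> is only controlled on free sets, so freeness of the initial segments is proved by induction.\<close>
  have step: "free_sequence X (Restr ?r J) x" "Field (Restr ?r J) = J"
    if J: "J \<subseteq> Field ?r" "\<And>\<beta>. \<beta> \<in> J \<Longrightarrow> free_set X (x ` underS ?r \<beta>)" for J
  proof -
    show F: "Field (Restr ?r J) = J"
      using wo J(1) by (intro Refl_Field_Restr2) (simp_all add: order_on_defs)
    have "(X closure_of (x ` underS (Restr ?r J) \<beta>)) \<inter> (X closure_of (x ` above (Restr ?r J) \<beta>)) = {}"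
      if "\<beta> \<in> J" for \<beta>
    proof -
      \<comment> \<open>This open set contains the closure of the initial segment and misses the
        final segment, hence also its closure.\<close>
      let ?G = "\<Union>(\<W> (x ` underS ?r \<beta>))"
      have "x ` underS ?r \<beta> \<subseteq> H" using x(1) by (auto simp: underS_def Field_def)
      then have "X closure_of (x ` underS ?r \<beta>) \<subseteq> ?G" using W(3) J(2)[OF that] by blast
      moreover have "X closure_of (x ` underS (Restr ?r J) \<beta>) \<subseteq> X closure_of (x ` underS ?r \<beta>)"
        by (intro closure_of_mono image_mono) (auto simp: underS_def)
      moreover have "openin X ?G" using W(1) opn by blast
      moreover have "?G \<inter> x ` above (Restr ?r J) \<beta> = {}" using x(2) unfolding above_def by blast
      ultimately show ?thesis using openin_Int_closure_of_eq_empty[of X ?G] by blast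
    qed
    then show "free_sequence X (Restr ?r J) x"
      using Well_order_Restr[OF wo, of J] J(1) x(1) H unfolding free_sequence_def F by blast
  qed
  have "\<beta> \<in> Field ?r \<longrightarrow> free_set X (x ` underS ?r \<beta>)" for \<beta>
  proof (induction \<beta> rule: wf_induct_rule[OF wf])
    case (1 \<beta>)
    have "free_set X (x ` underS ?r \<gamma>)" if "\<gamma> \<in> underS ?r \<beta>" for \<gamma>
      using 1[of \<gamma>] that unfolding underS_def Field_def by blast
    then show ?case
      using free_sequence_imp_free_set[OF step(1)] step(2) Order_Relation.underS_Field[of ?r \<beta>]
      by metis
  qed
  then have "free_sequence X ?r x" using step(1)[of "Field ?r"] by (simp add: Restr_Field)
  then have "inj_on x (Field ?r)" "|x ` Field ?r| \<le>o \<kappa>"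
    by (auto intro: free free_sequence_imp_free_set free_sequence_inj)
  then have "|Field ?r| \<le>o \<kappa>" by (rule card_le_if_inj_image)
  then show False using not_card_Field_cardSuc_le \<kappa> by blast
qed

section \<open>Transfer of subspace invariants to open sets of the ambient space\<close>

lemma lindelof_number_cover:
  assumes "lindelof_number (subtopology X Y) \<le>o \<kappa>"
    and "\<And>U. U \<in> \<U> \<Longrightarrow> openin X U" "Y \<subseteq> topspace X" "Y \<subseteq> \<Union>\<U>"
  shows "\<exists>\<V>\<subseteq>\<U>. |\<V>| \<le>o \<kappa> \<and> Y \<subseteq> \<Union>\<V>"
proof -
  let ?\<U> = "(\<lambda>U. Y \<inter> U) ` \<U>"
  have "\<forall>U\<in>?\<U>. openin (subtopology X Y) U" using assms(2) by (auto simp: openin_subtopology_Int2)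
  moreover have "\<Union>?\<U> = topspace (subtopology X Y)" using assms(3,4) by auto
  ultimately obtain \<V> where V: "\<V> \<subseteq> ?\<U>" "\<Union>\<V> = topspace (subtopology X Y)"
    "|\<V>| \<le>o lindelof_number (subtopology X Y)"
    using lindelof_number(2)[of "subtopology X Y"] by meson
  have "|\<V>| \<le>o \<kappa>" using V(3) assms(1) by (rule ordLeq_transitive)
  then obtain \<V>' where V': "\<V>' \<subseteq> \<U>" "\<V> = (\<lambda>U. Y \<inter> U) ` \<V>'" "|\<V>'| \<le>o \<kappa>"
    using subset_image_card[OF V(1)] by blast
  have "Y \<subseteq> \<Union>\<V>'" using V(2) V'(2) assms(3) by auto
  then show ?thesis using V'(1,3) by blast
qed

text \<open>\<open>cover_from_free_sets\<close> with the whole space as \<open>H\<close>; the bound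
  on \<open>FL\<close> covers the closures of free sets.\<close>

lemma lindelof_number_le:
  fixes \<kappa> :: "'k rel"
  assumes \<kappa>: "Cinfinite \<kappa>"
    and "free_number Y \<le>o \<kappa>" "free_lindelof_number Y \<le>o \<kappa>"
  shows "lindelof_number Y \<le>o \<kappa>"
proof (rule lindelof_number_least)
  show "Card_order \<kappa>" using \<kappa> by blast
  fix \<U> assume U: "\<forall>U\<in>\<U>. openin Y U" "\<Union>\<U> = topspace Y"
  have "|S| \<le>o \<kappa>" if "free_set Y S" for S
    using free_number(2)[of Y] that assms(2) ordLeq_transitive by blast
  moreover have "\<exists>\<V>\<subseteq>\<U>. |\<V>| \<le>o \<kappa> \<and> Y closure_of S \<subseteq> \<Union>\<V>" if "free_set Y S" for S
  proof (rule lindelof_number_cover)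
    show "lindelof_number (subtopology Y (Y closure_of S)) \<le>o \<kappa>"
      using free_lindelof_number(2)[of Y] that assms(3) ordLeq_transitive by blast
  qed (use U closure_of_subset_topspace in \<open>auto simp: closure_of_subset_topspace\<close>)
  ultimately have "\<exists>\<V>\<subseteq>\<U>. |\<V>| \<le>o \<kappa> \<and> topspace Y \<subseteq> \<Union>\<V>"
    using U(1) by (intro cover_from_free_sets[OF \<kappa>]) auto
  then show "\<exists>\<V>\<subseteq>\<U>. \<Union>\<V> = topspace Y \<and> |\<V>| \<le>o \<kappa>"
    using U(2) by blast
qed

lemma pseudocharacter_subspace_family:
  assumes "Hausdorff_space X" "pseudocharacter (subtopology X Y) \<le>o \<kappa>" "Y \<subseteq> topspace X" "p \<in> Y"
  shows "\<exists>\<U>. |\<U>| \<le>o \<kappa> \<and> (\<forall>U\<in>\<U>. openin X U \<and> p \<in> U) \<and> Y \<inter> \<Inter>\<U> = {p}"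
proof -
  let ?Y = "subtopology X Y"
  have Y: "Hausdorff_space ?Y" "p \<in> topspace ?Y" "topspace ?Y = Y"
    using assms by (auto simp: Hausdorff_space_subtopology)
  obtain \<U> where U: "\<forall>U\<in>\<U>. openin ?Y U" "topspace ?Y \<inter> \<Inter>\<U> = {p}"
    "|\<U>| =o pseudocharacter_at ?Y p"
    using pseudocharacter_at(2)[OF Y(1,2)] by blast
  have "\<forall>U\<in>\<U>. \<exists>W. openin X W \<and> U = W \<inter> Y" using U(1) by (simp add: openin_subtopology)
  then obtain f where f: "\<And>U. U \<in> \<U> \<Longrightarrow> openin X (f U) \<and> U = f U \<inter> Y" by metis
  have "|\<U>| \<le>o \<kappa>"
    using ordIso_ordLeq_trans[OF U(3)] pseudocharacter(2)[OF Y(1)] Y(2) assms(2)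
      ordLeq_transitive by blast
  then have "|f ` \<U>| \<le>o \<kappa>" by (rule card_le_image)
  moreover have "\<forall>U\<in>f ` \<U>. openin X U \<and> p \<in> U" using f U(2) by blast
  moreover have "Y \<inter> \<Inter>(f ` \<U>) = {p}"
  proof
    show "{p} \<subseteq> Y \<inter> \<Inter>(f ` \<U>)" using calculation(2) assms(4) by blast
    have "y = p" if "y \<in> Y \<inter> \<Inter>(f ` \<U>)" for y
    proof -
      have "y \<in> topspace ?Y \<inter> \<Inter>\<U>" using that f unfolding Y(3) by blast
      then show ?thesis unfolding U(2) by blast
    qed
    then show "Y \<inter> \<Inter>(f ` \<U>) \<subseteq> {p}" by blast
  qed
  ultimately show ?thesis by blast
qed

text \<open>For each \<open>U\<close> of a pseudobase at \<open>p\<close>, separate every point of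
  \<open>Y - U\<close> from \<open>p\<close> by disjoint open sets. By the Lindelof property
  \<kappa> many of them cover \<open>Y - U\<close>, and the matching neighbourhoods of
  \<open>p\<close> have closures that exclude these points.\<close>

lemma closed_pseudocharacter_subspace_family:
  fixes \<kappa> :: "'k rel"
  assumes \<kappa>: "Cinfinite \<kappa>" and X: "Hausdorff_space X"
    and L: "lindelof_number (subtopology X Y) \<le>o \<kappa>"
    and \<psi>: "pseudocharacter (subtopology X Y) \<le>o \<kappa>"
    and Y: "Y \<subseteq> topspace X" "p \<in> Y"
  shows "\<exists>\<W>. |\<W>| \<le>o \<kappa> \<and> (\<forall>W\<in>\<W>. openin X W \<and> p \<in> W) \<and>
    (\<forall>y\<in>Y. y \<noteq> p \<longrightarrow> (\<exists>W\<in>\<W>. y \<notin> X closure_of W))"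
proof -
  obtain \<U> where U: "|\<U>| \<le>o \<kappa>" "\<forall>U\<in>\<U>. openin X U \<and> p \<in> U" "Y \<inter> \<Inter>\<U> = {p}"
    using pseudocharacter_subspace_family[OF X \<psi> Y] by blast
  have "\<exists>V W. openin X V \<and> openin X W \<and> y \<in> V \<and> p \<in> W \<and> disjnt V W" if "y \<in> Y" "y \<noteq> p" for y
    using X Y that unfolding Hausdorff_space_def by blast
  then obtain V W where VW: "\<And>y. y \<in> Y \<Longrightarrow> y \<noteq> p \<Longrightarrow>
    openin X (V y) \<and> openin X (W y) \<and> y \<in> V y \<and> p \<in> W y \<and> disjnt (V y) (W y)" by metis
  have "\<exists>C. C \<subseteq> Y - U \<and> |C| \<le>o \<kappa> \<and> Y - U \<subseteq> \<Union>(V ` C)" if "U \<in> \<U>" for U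
  proof -
    have sub: "y \<in> Y \<and> y \<noteq> p" if "y \<in> Y - U" for y using that U(2) \<open>U \<in> \<U>\<close> by blast
    \<comment> \<open>Adding \<open>U\<close> completes a cover of \<open>Y - U\<close> to a cover
      of \<open>Y\<close>.\<close>
    have "\<exists>\<V>\<subseteq>insert U (V ` (Y - U)). |\<V>| \<le>o \<kappa> \<and> Y \<subseteq> \<Union>\<V>"
    proof (rule lindelof_number_cover[OF L _ Y(1)])
      fix A assume "A \<in> insert U (V ` (Y - U))"
      then show "openin X A" using U(2) \<open>U \<in> \<U>\<close> VW sub by auto
    next
      show "Y \<subseteq> \<Union> (insert U (V ` (Y - U)))" using VW sub by blast
    qed
    then obtain \<V> where \<V>: "\<V> \<subseteq> insert U (V ` (Y - U))" "|\<V>| \<le>o \<kappa>" "Y \<subseteq> \<Union>\<V>" by blast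
    have *: "\<V> - {U} \<subseteq> V ` (Y - U)" using \<V>(1) by blast
    have "|\<V> - {U}| \<le>o \<kappa>"
      by (rule ordLeq_transitive[OF card_of_mono1 \<V>(2)]) blast
    from subset_image_card[OF * this] obtain C where
      C: "C \<subseteq> Y - U" "\<V> - {U} = V ` C" "|C| \<le>o \<kappa>" by blast
    have "Y - U \<subseteq> \<Union>(V ` C)" using \<V>(3) C(2) by blast
    then show ?thesis using C(1,3) by blast
  qed
  then obtain C where C: "\<And>U. U \<in> \<U> \<Longrightarrow> C U \<subseteq> Y - U \<and> |C U| \<le>o \<kappa> \<and> Y - U \<subseteq> \<Union>(V ` C U)"
    by metis
  show ?thesis
  proof (intro exI conjI ballI impI)
    show "|\<Union>U\<in>\<U>. W ` C U| \<le>o \<kappa>"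
    proof (intro UNION_Cinfinite_bound U(1) \<kappa> ballI)
      fix U assume "U \<in> \<U>"
      then show "|W ` C U| \<le>o \<kappa>" using C card_le_image by blast
    qed
  next
    fix A assume "A \<in> (\<Union>U\<in>\<U>. W ` C U)"
    then obtain U c where A: "U \<in> \<U>" "c \<in> C U" "A = W c" by blast
    then have "c \<in> Y" "c \<noteq> p" using C[OF A(1)] U(2) by blast+
    then show "openin X A" "p \<in> A" using VW A(3) by blast+
  next
    fix y assume y: "y \<in> Y" "y \<noteq> p"
    then obtain U where "U \<in> \<U>" "y \<notin> U" using U(3) by blast
    then obtain c where c: "c \<in> C U" "y \<in> V c" using C y(1) by blast
    then have "c \<in> Y" "c \<noteq> p" using C[OF \<open>U \<in> \<U>\<close>] U(2) \<open>U \<in> \<U>\<close> by blast+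
    then have "openin X (V c)" "V c \<inter> W c = {}" using VW[of c] by (auto simp: disjnt_def)
    then have "V c \<inter> X closure_of (W c) = {}"
      by (simp add: openin_Int_closure_of_eq_empty)
    then show "\<exists>W\<in>(\<Union>U\<in>\<U>. W ` C U). y \<notin> X closure_of W"
      using c \<open>U \<in> \<U>\<close> by blast
  qed
qed

section \<open>Spaces whose small subsets lie in good subspaces\<close>

text \<open>The size bound on captured sets is \<open>2\<^sup>\<kappa>\<close> rather than \<kappa>
  because closures of small sets and sequences of length \<open>\<kappa>\<^sup>+\<close> have to be
  captured.\<close>

locale small_subsets_captured =
  fixes X :: "'a topology" and \<kappa> :: "'k rel"
  assumes Hausdorff: "Hausdorff_space X"
    and Cinfinite: "Cinfinite \<kappa>"
    and capture: "\<And>B. B \<subseteq> topspace X \<Longrightarrow> |B| \<le>o ctwo ^c \<kappa> \<Longrightarrow>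
      \<exists>Y\<subseteq>topspace X. B \<subseteq> Y \<and> lindelof_number (subtopology X Y) \<le>o \<kappa> \<and>
        free_number (subtopology X Y) \<le>o \<kappa> \<and> pseudocharacter (subtopology X Y) \<le>o \<kappa>"
begin

lemma Card_order: "Card_order \<kappa>"
  using Cinfinite by blast

lemma card_insert_le: "|A| \<le>o ctwo ^c \<kappa> \<Longrightarrow> |insert a A| \<le>o ctwo ^c \<kappa>"
  unfolding insert_is_Un[of a A]
  by (intro Un_Cinfinite_bound card_singleton_le Cinfinite_two_power Cinfinite)

text \<open>A larger free set would contain one of size \<open>\<kappa>\<^sup>+\<close>, which stays
  free in a good subspace capturing it.\<close>

lemma free_set_card_le:
  assumes S: "free_set X S"
  shows "|S| \<le>o \<kappa>"
proof (rule ccontr)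
  assume "\<not> |S| \<le>o \<kappa>"
  then have "\<not> |S| <o cardSuc \<kappa>" using card_less_cardSuc[OF Card_order] by blast
  then have "cardSuc \<kappa> \<le>o |S|"
    using cardSuc_Card_order[OF Card_order] card_of_Well_order
    unfolding card_order_on_def by (meson not_ordLess_iff_ordLeq)
  then have "|Field (cardSuc \<kappa>)| \<le>o |S|"
    by (rule ordIso_ordLeq_trans[OF card_of_Field_ordIso[OF cardSuc_Card_order[OF Card_order]]])
  then obtain f where f: "inj_on f (Field (cardSuc \<kappa>))" "f ` Field (cardSuc \<kappa>) \<subseteq> S"
    unfolding card_of_ordLeq[symmetric] by blast
  let ?B = "f ` Field (cardSuc \<kappa>)"
  have "?B \<subseteq> topspace X" using f(2) free_set_subset[OF S] by blast
  from capture[OF this card_le_image[OF card_Field_cardSuc_le[OF Card_order]]]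
  obtain Y where Y: "?B \<subseteq> Y" "free_number (subtopology X Y) \<le>o \<kappa>" by blast
  have "free_set (subtopology X Y) ?B"
    by (rule free_set_subtopology[OF free_set_mono[OF S f(2)] Y(1)])
  then have "|?B| \<le>o free_number (subtopology X Y)"
    using free_number(2)[of "subtopology X Y"] by blast
  then have "|?B| \<le>o \<kappa>" using Y(2) by (rule ordLeq_transitive)
  then have "|Field (cardSuc \<kappa>)| \<le>o \<kappa>" by (rule card_le_if_inj_image[OF f(1)])
  then show False using not_card_Field_cardSuc_le[OF Card_order] by blast
qed

text \<open>
  A point of the closure of \<open>A\<close> is recovered from the traces on \<open>A\<close> of \<open>\<kappa>\<close> many of its neighbourhoods.
  That one family of traces works for all of \<open>X\<close>, not only inside one good subspace, follows by
  putting a counterexample for each of the \<open>2\<^sup>\<kappa>\<close> families into one good subspace.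
\<close>

lemma card_closure_le:
  assumes A: "A \<subseteq> topspace X" "|A| \<le>o \<kappa>"
  shows "|X closure_of A| \<le>o ctwo ^c \<kappa>"
proof -
  define \<E> where "\<E> = {\<A>. \<A> \<subseteq> Pow A \<and> |\<A>| \<le>o \<kappa>}"
  have E: "|\<E>| \<le>o ctwo ^c \<kappa>"
    unfolding \<E>_def by (rule card_subsets_bound[OF Cinfinite card_Pow_le[OF Card_order A(2)]])
  \<comment> \<open>\<A> is a code for \<open>p\<close> when \<open>I \<A> = {p}\<close>; every
    point of the closure receives a code in \<open>\<E>\<close>.\<close>
  define I where "I \<A> = {q \<in> topspace X. \<forall>E\<in>\<A>. q \<in> X closure_of E}" for \<A>
  have ex: "\<exists>\<A>\<in>\<E>. I \<A> = {p}" if p: "p \<in> X closure_of A" for p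
  proof (rule ccontr)
    assume no: "\<not> ?thesis"
    have pX: "p \<in> topspace X" using p closure_of_subset_topspace by fastforce
    define \<F> where "\<F> = {\<A> \<in> \<E>. p \<in> I \<A>}"
    have "\<forall>\<A>\<in>\<F>. \<exists>q. q \<in> I \<A> \<and> q \<noteq> p" using no unfolding \<F>_def by blast
    from bchoice[OF this] obtain q where q: "\<And>\<A>. \<A> \<in> \<F> \<Longrightarrow> q \<A> \<in> I \<A> \<and> q \<A> \<noteq> p"
      by blast
    have "|\<F>| \<le>o ctwo ^c \<kappa>" by (rule ordLeq_transitive[OF card_of_mono1 E]) (auto simp: \<F>_def)
    then have *: "|insert p (q ` \<F>)| \<le>o ctwo ^c \<kappa>" by (intro card_insert_le card_le_image)
    have "insert p (q ` \<F>) \<subseteq> topspace X" using q pX unfolding I_def by blast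
    from capture[OF this *] obtain Y where Y: "Y \<subseteq> topspace X" "insert p (q ` \<F>) \<subseteq> Y"
      "lindelof_number (subtopology X Y) \<le>o \<kappa>" "pseudocharacter (subtopology X Y) \<le>o \<kappa>"
      by blast
    have "p \<in> Y" using Y(2) by blast
    from closed_pseudocharacter_subspace_family[OF Cinfinite Hausdorff Y(3,4,1) this]
    obtain \<W> where W: "|\<W>| \<le>o \<kappa>" "\<And>W. W \<in> \<W> \<Longrightarrow> openin X W \<and> p \<in> W"
      "\<And>y. y \<in> Y \<Longrightarrow> y \<noteq> p \<Longrightarrow> \<exists>W\<in>\<W>. y \<notin> X closure_of W" by blast
    \<comment> \<open>The traces on \<open>A\<close> of the neighbourhoods separating
      \<open>p\<close> inside \<open>Y\<close> form a member of \<open>\<F>\<close>. Its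
      counterexample lies in \<open>Y\<close> and in the closure of every \<open>W\<close>, against
      the choice of \<open>\<W>\<close>.\<close>
    let ?\<A> = "(\<lambda>W. W \<inter> A) ` \<W>"
    have "|?\<A>| \<le>o \<kappa>" using W(1) by (rule card_le_image)
    moreover have "p \<in> X closure_of (W \<inter> A)" if "W \<in> \<W>" for W
      using openin_Int_closure_of_subset[of X W A] W(2)[OF that] p by blast
    ultimately have A': "?\<A> \<in> \<F>" using pX unfolding \<F>_def \<E>_def I_def by blast
    have q': "q ?\<A> \<noteq> p" "\<forall>W\<in>\<W>. q ?\<A> \<in> X closure_of (W \<inter> A)"
      using q[OF A'] unfolding I_def by blast+
    have "q ?\<A> \<in> Y" using Y(2) A' by blast
    from W(3)[OF this q'(1)] obtain W where "W \<in> \<W>" "q ?\<A> \<notin> X closure_of W" by blast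
    then show False using q'(2) closure_of_mono[of "W \<inter> A" W X] by blast
  qed
  have "X closure_of A \<subseteq> (\<lambda>\<A>. THE p. I \<A> = {p}) ` \<E>"
  proof
    fix p assume "p \<in> X closure_of A"
    then obtain \<A> where "\<A> \<in> \<E>" "I \<A> = {p}" using ex by blast
    moreover from this(2) have "(THE p. I \<A> = {p}) = p" by simp
    ultimately show "p \<in> (\<lambda>\<A>. THE p. I \<A> = {p}) ` \<E>" by (intro image_eqI[of _ _ \<A>]) simp_all
  qed
  from surj_imp_ordLeq[OF this] E show ?thesis by (rule ordLeq_transitive)
qed

text \<open>The point \<open>p\<close> is adjoined because it may lie outside the closure of
  \<open>A\<close>, while families at \<open>p\<close> require \<open>p \<in> Y\<close>.\<close>

lemma closure_capture:
  assumes "A \<subseteq> topspace X" "|A| \<le>o \<kappa>" "p \<in> topspace X"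
  shows "\<exists>Y\<subseteq>topspace X. p \<in> Y \<and> X closure_of A \<subseteq> Y \<and> lindelof_number (subtopology X Y) \<le>o \<kappa> \<and>
    pseudocharacter (subtopology X Y) \<le>o \<kappa>"
proof -
  have "insert p (X closure_of A) \<subseteq> topspace X"
    using assms(3) closure_of_subset_topspace[of X A] by blast
  from capture[OF this card_insert_le[OF card_closure_le[OF assms(1,2)]]] show ?thesis by blast
qed

text \<open>The closure is relatively closed in a captured \<kappa>-Lindelof \<open>Y\<close>, so
  its complement is added to the cover and discarded afterwards.\<close>

lemma closure_cover:
  assumes A: "A \<subseteq> topspace X" "|A| \<le>o \<kappa>"
    and U: "\<And>U. U \<in> \<U> \<Longrightarrow> openin X U" "X closure_of A \<subseteq> \<Union>\<U>"
  shows "\<exists>\<V>\<subseteq>\<U>. |\<V>| \<le>o \<kappa> \<and> X closure_of A \<subseteq> \<Union>\<V>"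
proof -
  let ?C = "topspace X - X closure_of A"
  obtain Y where Y: "Y \<subseteq> topspace X" "X closure_of A \<subseteq> Y"
    "lindelof_number (subtopology X Y) \<le>o \<kappa>"
    using capture[OF closure_of_subset_topspace card_closure_le[OF A]] by blast
  have "\<exists>\<V>\<subseteq>insert ?C \<U>. |\<V>| \<le>o \<kappa> \<and> Y \<subseteq> \<Union>\<V>"
  proof (rule lindelof_number_cover[OF Y(3) _ Y(1)])
    show "openin X U" if "U \<in> insert ?C \<U>" for U
      using that U(1) by (auto intro: openin_diff)
    show "Y \<subseteq> \<Union>(insert ?C \<U>)" using Y(1) U(2) by blast
  qed
  then obtain \<V> where V: "\<V> \<subseteq> insert ?C \<U>" "|\<V>| \<le>o \<kappa>" "Y \<subseteq> \<Union>\<V>" by blast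
  have "|\<V> - {?C}| \<le>o \<kappa>" by (rule ordLeq_transitive[OF card_of_mono1 V(2)]) blast
  moreover have "\<V> - {?C} \<subseteq> \<U>" "X closure_of A \<subseteq> \<Union>(\<V> - {?C})" using V(1,3) Y(2) by blast+
  ultimately show ?thesis by blast
qed

text \<open>
  Otherwise one finds points \<open>x\<^sub>\<beta>\<close> for \<open>\<beta> < \<kappa>\<^sup>+\<close> such that the closures of the initial and final segments
  meet at most in \<open>p\<close>. All of them lie in one good subspace, so \<open>\<kappa>\<^sup>+\<close> many avoid a common
  neighbourhood of \<open>p\<close>, and these form a free sequence.
\<close>

lemma pseudocharacter_family_le:
  assumes p: "p \<in> topspace X"
  shows "\<exists>\<U>. |\<U>| \<le>o \<kappa> \<and> (\<forall>U\<in>\<U>. openin X U \<and> p \<in> U) \<and>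
    (\<forall>q\<in>topspace X. q \<noteq> p \<longrightarrow> (\<exists>U\<in>\<U>. q \<notin> U))"
proof (rule ccontr)
  assume no: "\<not> ?thesis"
  let ?r = "cardSuc \<kappa>"
  let ?P = "\<lambda>A \<W>. |\<W>| \<le>o \<kappa> \<and> (\<forall>W\<in>\<W>. openin X W \<and> p \<in> W) \<and>
    (A \<subseteq> topspace X \<and> |A| \<le>o \<kappa> \<longrightarrow> (\<forall>y\<in>X closure_of A. y \<noteq> p \<longrightarrow> (\<exists>W\<in>\<W>. y \<notin> X closure_of W)))"
  have "\<exists>\<W>. ?P A \<W>" for A
  proof (cases "A \<subseteq> topspace X \<and> |A| \<le>o \<kappa>")
    case True
    then have A: "A \<subseteq> topspace X" "|A| \<le>o \<kappa>" by simp_all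
    from closure_capture[OF A p]
    obtain Y where Y: "Y \<subseteq> topspace X" "p \<in> Y" "X closure_of A \<subseteq> Y"
      "lindelof_number (subtopology X Y) \<le>o \<kappa>" "pseudocharacter (subtopology X Y) \<le>o \<kappa>"
      by blast
    from closed_pseudocharacter_subspace_family[OF Cinfinite Hausdorff Y(4,5,1,2)]
    obtain \<W> where "|\<W>| \<le>o \<kappa>" "\<forall>W\<in>\<W>. openin X W \<and> p \<in> W"
      "\<forall>y\<in>Y. y \<noteq> p \<longrightarrow> (\<exists>W\<in>\<W>. y \<notin> X closure_of W)" by blast
    then show ?thesis using Y(3) by (intro exI[of _ \<W>]) blast
  next
    case False
    then show ?thesis
      using Card_order by (intro exI[of _ "{}"] conjI) (auto simp: card_of_empty1)
  qed
  then have "\<forall>A. \<exists>\<W>. ?P A \<W>" by (rule allI)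
  from choice[OF this] obtain \<W> where "\<forall>A. ?P A (\<W> A)" by (elim exE) (rule that)
  then have W: "\<And>A. |\<W> A| \<le>o \<kappa>" "\<And>A W. W \<in> \<W> A \<Longrightarrow> openin X W \<and> p \<in> W"
    "\<And>A y. A \<subseteq> topspace X \<Longrightarrow> |A| \<le>o \<kappa> \<Longrightarrow> y \<in> X closure_of A \<Longrightarrow> y \<noteq> p \<Longrightarrow>
      \<exists>W\<in>\<W> A. y \<notin> X closure_of W" by simp_all
  have "\<exists>y\<in>topspace X - {p}. \<forall>V\<in>\<V>. y \<in> V" if "\<V> \<subseteq> \<Union>(range \<W>)" "|\<V>| \<le>o \<kappa>" for \<V>
  proof -
    have "\<forall>V\<in>\<V>. openin X V \<and> p \<in> V" using that(1) W(2) by blast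
    then have "\<not> (\<forall>q\<in>topspace X. q \<noteq> p \<longrightarrow> (\<exists>V\<in>\<V>. q \<notin> V))" using no that(2) by blast
    then show ?thesis by blast
  qed
  from long_sequence[of \<kappa> \<W> "topspace X - {p}" "\<lambda>y V. y \<in> V", OF Cinfinite W(1) this]
  obtain x where x: "\<And>\<beta>. \<beta> \<in> Field ?r \<Longrightarrow> x \<beta> \<in> topspace X - {p}"
    "\<And>\<beta> \<gamma> W. (\<gamma>, \<beta>) \<in> ?r \<Longrightarrow> W \<in> \<W> (x ` underS ?r \<gamma>) \<Longrightarrow> x \<beta> \<in> W" by blast
  have split: "X closure_of (x ` underS ?r \<beta>) \<inter> X closure_of (x ` above ?r \<beta>) \<subseteq> {p}"
    if \<beta>: "\<beta> \<in> Field ?r" for \<beta>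
  proof
    fix y assume y: "y \<in> X closure_of (x ` underS ?r \<beta>) \<inter> X closure_of (x ` above ?r \<beta>)"
    show "y \<in> {p}"
    proof (rule ccontr)
      assume "y \<notin> {p}"
      moreover have "x ` underS ?r \<beta> \<subseteq> topspace X" using x(1) by (auto simp: underS_def Field_def)
      moreover have "|x ` underS ?r \<beta>| \<le>o \<kappa>"
        by (rule card_le_image[OF card_under_cardSuc(1)[OF Cinfinite \<beta>]])
      ultimately have "\<exists>W\<in>\<W> (x ` underS ?r \<beta>). y \<notin> X closure_of W"
        using y by (intro W(3)) auto
      then obtain W where w: "W \<in> \<W> (x ` underS ?r \<beta>)" "y \<notin> X closure_of W" by blast
      \<comment> \<open>Every term from \<beta> on was chosen inside the sets attached to the
        segment below \<beta>.\<close>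
      have "x ` above ?r \<beta> \<subseteq> W" using x(2)[OF _ w(1)] by (auto simp: above_def)
      then show False using closure_of_mono[of "x ` above ?r \<beta>" W X] w(2) y by blast
    qed
  qed
  have *: "|insert p (x ` Field ?r)| \<le>o ctwo ^c \<kappa>"
    by (intro card_insert_le card_le_image card_Field_cardSuc_le Card_order)
  have "insert p (x ` Field ?r) \<subseteq> topspace X" using x(1) p by blast
  from capture[OF this *] obtain Y where Y: "Y \<subseteq> topspace X" "insert p (x ` Field ?r) \<subseteq> Y"
    "pseudocharacter (subtopology X Y) \<le>o \<kappa>"
    by blast
  have "p \<in> Y" using Y(2) by blast
  from pseudocharacter_subspace_family[OF Hausdorff Y(3,1) this]
  obtain \<U> where U: "|\<U>| \<le>o \<kappa>" "\<And>U. U \<in> \<U> \<Longrightarrow> openin X U \<and> p \<in> U" "Y \<inter> \<Inter>\<U> = {p}" by blast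
  let ?J = "\<lambda>U. {\<beta> \<in> Field ?r. x \<beta> \<notin> U}"
  have "\<beta> \<in> (\<Union>U\<in>\<U>. ?J U)" if "\<beta> \<in> Field ?r" for \<beta>
  proof -
    have "x \<beta> \<in> Y" "x \<beta> \<noteq> p" using that Y(2) x(1) by blast+
    then have "x \<beta> \<notin> \<Inter>\<U>" using U(3) by blast
    then show ?thesis using that by blast
  qed
  then have "Field ?r \<subseteq> (\<Union>U\<in>\<U>. ?J U)" by blast
  \<comment> \<open>Pigeonhole: \<kappa> many sets of size at most \<kappa> cannot cover
    \<open>Field ?r\<close>.\<close>
  then have "\<not> (\<forall>U\<in>\<U>. |?J U| \<le>o \<kappa>)"
    using UNION_Cinfinite_bound[OF U(1) _ Cinfinite, of ?J] not_card_Field_cardSuc_le[OF Card_order]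
      ordLeq_transitive[OF card_of_mono1, of "Field ?r" "\<Union>U\<in>\<U>. ?J U" \<kappa>] by blast
  then obtain U where JU: "U \<in> \<U>" "\<not> |?J U| \<le>o \<kappa>" by blast
  let ?s = "Restr ?r (?J U)"
  have wo: "Well_order ?r"
    using cardSuc_Card_order[OF Card_order] unfolding card_order_on_def by blast
  have F: "Field ?s = ?J U"
    using wo by (intro Refl_Field_Restr2) (auto simp: order_on_defs)
  have "X closure_of (x ` underS ?s \<beta>) \<inter> X closure_of (x ` above ?s \<beta>) = {}" if "\<beta> \<in> ?J U" for \<beta>
  proof -
    have "X closure_of (x ` underS ?s \<beta>) \<subseteq> X closure_of (x ` underS ?r \<beta>)"
      "X closure_of (x ` above ?s \<beta>) \<subseteq> X closure_of (x ` above ?r \<beta>)"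
      by (intro closure_of_mono image_mono; auto simp: underS_def above_def)+
    \<comment> \<open>All terms indexed by \<open>?J U\<close> avoid the neighbourhood
      \<open>U\<close> of \<open>p\<close>, so \<open>p\<close>, the only common point
      \<open>split\<close> permits, is excluded.\<close>
    moreover have "U \<inter> x ` underS ?s \<beta> = {}" by (auto simp: underS_def)
    then have "U \<inter> X closure_of (x ` underS ?s \<beta>) = {}"
      using U(2)[OF JU(1)] by (simp add: openin_Int_closure_of_eq_empty)
    ultimately show ?thesis using split[of \<beta>] that U(2)[OF JU(1)] by blast
  qed
  then have "free_sequence X ?s x"
    using Well_order_Restr[OF wo, of "?J U"] x(1) unfolding free_sequence_def F by blast
  then have "inj_on x (Field ?s)" "|x ` Field ?s| \<le>o \<kappa>"
    by (auto intro: free_sequence_inj free_set_card_le free_sequence_imp_free_set)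
  then have "|?J U| \<le>o \<kappa>" unfolding F by (rule card_le_if_inj_image)
  then show False using JU(2) by blast
qed

lemma card_topspace_le: "|topspace X| \<le>o ctwo ^c \<kappa>"
proof -
  have "\<forall>p\<in>topspace X. \<exists>\<U>. |\<U>| \<le>o \<kappa> \<and> (\<forall>U\<in>\<U>. openin X U \<and> p \<in> U) \<and>
    (\<forall>q\<in>topspace X. q \<noteq> p \<longrightarrow> (\<exists>U\<in>\<U>. q \<notin> U))"
    using pseudocharacter_family_le by (rule ballI)
  from bchoice[OF this] obtain \<U> where "\<forall>p\<in>topspace X. |\<U> p| \<le>o \<kappa> \<and> (\<forall>U\<in>\<U> p. openin X U \<and> p \<in> U) \<and>
    (\<forall>q\<in>topspace X. q \<noteq> p \<longrightarrow> (\<exists>U\<in>\<U> p. q \<notin> U))" by (elim exE) (rule that)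
  then have U: "\<And>p. p \<in> topspace X \<Longrightarrow> |\<U> p| \<le>o \<kappa>"
    "\<And>p U. p \<in> topspace X \<Longrightarrow> U \<in> \<U> p \<Longrightarrow> openin X U \<and> p \<in> U"
    "\<And>p q. p \<in> topspace X \<Longrightarrow> q \<in> topspace X \<Longrightarrow> q \<noteq> p \<Longrightarrow> \<exists>U\<in>\<U> p. q \<notin> U"
    by simp_all
  define q where "q \<V> = (SOME y. y \<in> topspace X - \<Union>\<V>)" for \<V>
  have q: "q \<V> \<in> topspace X - \<Union>\<V>" if "\<not> topspace X \<subseteq> \<Union>\<V>" for \<V>
    unfolding q_def some_in_eq using that by blast
  \<comment> \<open>Families of chosen neighbourhoods of points of \<open>S\<close> that fail to
    cover \<open>X\<close>; \<open>?F\<close> adds a missed point \<open>q \<V>\<close> for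
    each.\<close>
  let ?V = "\<lambda>S. {\<V>. \<V> \<subseteq> \<Union>(\<U> ` S) \<and> \<not> topspace X \<subseteq> \<Union>\<V>}"
  let ?F = "\<lambda>S. X closure_of S \<union> q ` ?V S"
  have "?F S \<subseteq> topspace X \<and> |?F S| \<le>o ctwo ^c \<kappa>" if S: "S \<subseteq> topspace X" "|S| \<le>o \<kappa>" for S
  proof
    show "?F S \<subseteq> topspace X" using closure_of_subset_topspace[of X S] q by blast
    have "|\<Union>(\<U> ` S)| \<le>o \<kappa>" using S U(1) by (intro UNION_Cinfinite_bound Cinfinite) blast+
    then have "|Pow (\<Union>(\<U> ` S))| \<le>o ctwo ^c \<kappa>" by (rule card_Pow_le[OF Card_order])
    then have "|?V S| \<le>o ctwo ^c \<kappa>" by (rule ordLeq_transitive[OF card_of_mono1, rotated]) blast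
    then show "|?F S| \<le>o ctwo ^c \<kappa>"
      using S by (intro Un_Cinfinite_bound card_closure_le card_le_image Cinfinite_two_power Cinfinite)
  qed
  from closing_off[of \<kappa> "topspace X" ?F, OF Cinfinite this]
  obtain H where H: "H \<subseteq> topspace X" "|H| \<le>o ctwo ^c \<kappa>" "\<And>S. S \<subseteq> H \<Longrightarrow> |S| \<le>o \<kappa> \<Longrightarrow> ?F S \<subseteq> H"
    by blast
  have "topspace X \<subseteq> H"
  proof (rule ccontr)
    assume "\<not> topspace X \<subseteq> H"
    then obtain p where p: "p \<in> topspace X" "p \<notin> H" by blast
    have "\<forall>x\<in>H. \<exists>U. U \<in> \<U> x \<and> p \<notin> U" using U(3) H(1) p by blast
    from bchoice[OF this] obtain f where f: "\<And>x. x \<in> H \<Longrightarrow> f x \<in> \<U> x \<and> p \<notin> f x" by blast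
    have opn: "openin X V" if "V \<in> f ` H" for V using that f U(2) H(1) by blast
    have cov: "H \<subseteq> \<Union>(f ` H)" using f U(2) H(1) by blast
    have "\<exists>\<V>\<subseteq>f ` H. |\<V>| \<le>o \<kappa> \<and> H \<subseteq> \<Union>\<V>"
    proof (rule cover_from_free_sets[OF Cinfinite free_set_card_le opn H(1)])
      fix S assume S: "S \<subseteq> H" "free_set X S"
      have "|S| \<le>o \<kappa>" using S(2) by (rule free_set_card_le)
      \<comment> \<open>\<open>H\<close> contains the closures of its small subsets, so the
        neighbourhoods covering \<open>H\<close> cover this closure.\<close>
      moreover from H(3)[OF S(1) this] have "X closure_of S \<subseteq> \<Union>(f ` H)" using cov by blast
      moreover have "S \<subseteq> topspace X" using S(1) H(1) by blast
      ultimately show "\<exists>\<V>\<subseteq>f ` H. |\<V>| \<le>o \<kappa> \<and> X closure_of S \<subseteq> \<Union>\<V>"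
        using opn by (intro closure_cover)
    qed
    then obtain \<V> where V: "\<V> \<subseteq> f ` H" "|\<V>| \<le>o \<kappa>" "H \<subseteq> \<Union>\<V>" by blast
    from subset_image_card[OF V(1,2)] obtain S where S: "S \<subseteq> H" "\<V> = f ` S" "|S| \<le>o \<kappa>" by blast
    have "p \<notin> \<Union>\<V>" using f S(1,2) by blast
    then have nt: "\<not> topspace X \<subseteq> \<Union>\<V>" using p(1) by blast
    moreover have "\<V> \<subseteq> \<Union>(\<U> ` S)" using f S(1,2) by blast
    \<comment> \<open>\<open>\<V>\<close> comes from the small set \<open>S \<subseteq> H\<close>
      and misses \<open>p\<close>, so closing off puts \<open>q \<V>\<close> into \<open>H\<close>,
      which \<open>\<V>\<close> covers.\<close>
    ultimately have "q \<V> \<in> H" using H(3)[OF S(1,3)] by blast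
    then show False using q[OF nt] V(3) by blast
  qed
  then show ?thesis using H(2) by (rule ordLeq_transitive[OF card_of_mono1])
qed

end

section \<open>Chains of subspaces\<close>

lemma Cnotzero_lindelof_number:
  assumes "topspace Y \<noteq> {}"
  shows "Cnotzero (lindelof_number Y)"
proof -
  have "\<forall>U\<in>{topspace Y}. openin Y U" "\<Union>{topspace Y} = topspace Y" by simp_all
  then obtain \<V> where V: "\<Union>\<V> = topspace Y" "|\<V>| \<le>o lindelof_number Y"
    using lindelof_number(2)[of Y] by meson
  have "\<V> \<noteq> {}" using V(1) assms by force
  then show ?thesis
    using Cnotzero_mono[OF Cnotzero_card_of lindelof_number(1) V(2)] by blast
qed

lemma Cnotzero_free_number:
  assumes "t1_space Y" "x \<in> topspace Y"
  shows "Cnotzero (free_number Y)"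
proof -
  have "|{x}| \<le>o free_number Y"
    using free_number(2)[of Y] free_set_finite[OF assms(1), of "{x}"] assms(2) by simp
  then show ?thesis by (rule Cnotzero_mono[OF Cnotzero_card_of free_number(1), rotated]) simp
qed

lemma Cnotzero_free_lindelof_number:
  assumes "t1_space Y" "x \<in> topspace Y"
  shows "Cnotzero (free_lindelof_number Y)"
proof (rule Cnotzero_mono[OF Cnotzero_lindelof_number free_lindelof_number(1)])
  show "lindelof_number (subtopology Y (Y closure_of {x})) \<le>o free_lindelof_number Y"
    using free_lindelof_number(2)[of Y] free_set_finite[OF assms(1), of "{x}"] assms(2) by simp
  have "x \<in> Y closure_of {x}" using assms(2) by (simp add: in_closure_of)
  then show "topspace (subtopology Y (Y closure_of {x})) \<noteq> {}" using assms(2) by auto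
qed

text \<open>On a one-point space the empty family witnesses pseudocharacter 0, so two points are needed.\<close>

lemma Cnotzero_pseudocharacter:
  assumes Y: "Hausdorff_space Y" and x: "x \<in> topspace Y" and y: "y \<in> topspace Y" "x \<noteq> y"
  shows "Cnotzero (pseudocharacter Y)"
proof -
  obtain \<U> where U: "topspace Y \<inter> \<Inter>\<U> = {x}" "|\<U>| =o pseudocharacter_at Y x"
    using pseudocharacter_at(2)[OF Y x] by blast
  have "\<U> \<noteq> {}" using U(1) y by auto
  moreover have "pseudocharacter_at Y x \<le>o pseudocharacter Y"
    using pseudocharacter(2)[OF Y] x by blast
  with U(2) have "|\<U>| \<le>o pseudocharacter Y" by (rule ordIso_ordLeq_trans)
  ultimately show ?thesis
    using Cnotzero_mono[OF Cnotzero_card_of pseudocharacter(1)[OF Y]] by blast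
qed

text \<open>A factor is sure to lie below the product only when the other factors are nonzero; for
  the pseudocharacter this takes two points.\<close>

lemma factors_le:
  assumes Y: "Hausdorff_space Y" and x: "x \<in> topspace Y" and y: "y \<in> topspace Y" "x \<noteq> y"
    and le: "free_lindelof_number Y *c free_number Y *c pseudocharacter Y \<le>o \<kappa>"
  shows "free_lindelof_number Y \<le>o \<kappa>" "free_number Y \<le>o \<kappa>" "pseudocharacter Y \<le>o \<kappa>"
proof -
  have t1: "t1_space Y" using Y by (rule Hausdorff_imp_t1_space)
  note FL = Cnotzero_free_lindelof_number[OF t1 x]
    and F = Cnotzero_free_number[OF t1 x]
    and \<psi> = Cnotzero_pseudocharacter[OF Y x y]
  have "free_lindelof_number Y \<le>o free_lindelof_number Y *c free_number Y *c pseudocharacter Y"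
    using FL F \<psi> by (intro ordLeq_cprod1 Cnotzero_cprod) simp_all
  then show "free_lindelof_number Y \<le>o \<kappa>" using le by (rule ordLeq_transitive)
  have *: "free_number Y *c pseudocharacter Y \<le>o \<kappa>"
    using FL by (intro ordLeq_transitive[OF ordLeq_cprod2 le] Card_order_cprod)
  show "free_number Y \<le>o \<kappa>"
    using F \<psi> by (intro ordLeq_transitive[OF ordLeq_cprod1 *]) simp_all
  show "pseudocharacter Y \<le>o \<kappa>"
    using F \<psi> by (intro ordLeq_transitive[OF ordLeq_cprod2 *]) simp_all
qed

text \<open>With at most one point the product may vanish and say nothing about its factors; then
  the size of the space bounds all three invariants.\<close>

lemma invariants_le:
  assumes Y: "Hausdorff_space Y" and \<kappa>: "Cinfinite \<kappa>"
    and le: "free_lindelof_number Y *c free_number Y *c pseudocharacter Y \<le>o \<kappa>"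
  shows "lindelof_number Y \<le>o \<kappa>" "free_number Y \<le>o \<kappa>" "pseudocharacter Y \<le>o \<kappa>"
proof -
  have "lindelof_number Y \<le>o \<kappa> \<and> free_number Y \<le>o \<kappa> \<and> pseudocharacter Y \<le>o \<kappa>"
  proof (cases "\<exists>x y. x \<in> topspace Y \<and> y \<in> topspace Y \<and> x \<noteq> y")
    case True
    then obtain x y where "x \<in> topspace Y" "y \<in> topspace Y" "x \<noteq> y" by blast
    note f = factors_le[OF Y this le]
    show ?thesis using lindelof_number_le[OF \<kappa> f(2,1)] f(2,3) by blast
  next
    case False
    \<comment> \<open>This covers the empty space too, whatever \<open>SOME\<close> returns.\<close>
    then have "topspace Y \<subseteq> {SOME x. x \<in> topspace Y}" by (metis singletonI someI subsetI)
    then have small: "|topspace Y| \<le>o \<kappa>"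
      by (rule ordLeq_transitive[OF card_of_mono1 card_singleton_le[OF \<kappa>]])
    show ?thesis
    proof (intro conjI)
      show "lindelof_number Y \<le>o \<kappa>"
        by (rule ordLeq_transitive[OF lindelof_number_le_card small])
      show "free_number Y \<le>o \<kappa>"
        by (rule free_number_least) (use \<kappa> free_set_card ordLeq_transitive[OF _ small] in blast)+
      show "pseudocharacter Y \<le>o \<kappa>"
        using Y \<kappa> by (intro pseudocharacter_least ordLeq_transitive[OF pseudocharacter_at_bound small]) simp_all
    qed
  qed
  then show "lindelof_number Y \<le>o \<kappa>" "free_number Y \<le>o \<kappa>" "pseudocharacter Y \<le>o \<kappa>" by simp_all
qed

text \<open>A good space captures all of its subsets, with the whole space as
  \<open>Y\<close>.\<close>

lemma card_topspace_le_exp: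
  assumes "Hausdorff_space Y" "Cinfinite \<kappa>"
    and "lindelof_number Y \<le>o \<kappa>" "free_number Y \<le>o \<kappa>" "pseudocharacter Y \<le>o \<kappa>"
  shows "|topspace Y| \<le>o ctwo ^c \<kappa>"
proof -
  interpret small_subsets_captured Y \<kappa>
    by unfold_locales (use assms in \<open>auto intro!: exI[of _ "topspace Y"]\<close>)
  show ?thesis by (rule card_topspace_le)
qed

section \<open>Subsets of the union of a chain\<close>

lemma chain_comparable:
  assumes "Well_order \<Lambda>" "\<And>\<alpha> \<beta>. (\<alpha>, \<beta>) \<in> \<Lambda> \<Longrightarrow> Xs \<alpha> \<subseteq> Xs \<beta>" "\<alpha> \<in> Field \<Lambda>" "\<beta> \<in> Field \<Lambda>"
  shows "Xs \<alpha> \<subseteq> Xs \<beta> \<or> Xs \<beta> \<subseteq> Xs \<alpha>"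
proof -
  have "\<alpha> = \<beta> \<or> (\<alpha>, \<beta>) \<in> \<Lambda> \<or> (\<beta>, \<alpha>) \<in> \<Lambda>"
    using assms(1,3,4) unfolding order_on_defs total_on_def by blast
  then show ?thesis using assms(2) by blast
qed

text \<open>If each \<open>Xs \<alpha>\<close> omits some \<open>b\<close> of \<open>B\<close>, it
  lies below the member \<open>Xs (a b)\<close> containing \<open>b\<close>. Then at most
  \<open>c\<close> members of size at most \<open>c\<close> already exhaust the union.\<close>

lemma subset_in_chain:
  assumes \<Lambda>: "Well_order \<Lambda>"
    and mono: "\<And>\<alpha> \<beta>. (\<alpha>, \<beta>) \<in> \<Lambda> \<Longrightarrow> Xs \<alpha> \<subseteq> Xs \<beta>"
    and small: "\<And>\<alpha>. \<alpha> \<in> Field \<Lambda> \<Longrightarrow> |Xs \<alpha>| \<le>o c"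
    and c: "Cinfinite c" and big: "\<not> |\<Union>\<alpha>\<in>Field \<Lambda>. Xs \<alpha>| \<le>o c"
    and B: "B \<subseteq> (\<Union>\<alpha>\<in>Field \<Lambda>. Xs \<alpha>)" "|B| \<le>o c"
  shows "\<exists>\<alpha>\<in>Field \<Lambda>. B \<subseteq> Xs \<alpha>"
proof (rule ccontr)
  assume no: "\<not> ?thesis"
  have "\<forall>b\<in>B. \<exists>\<alpha>. \<alpha> \<in> Field \<Lambda> \<and> b \<in> Xs \<alpha>" using B(1) by blast
  from bchoice[OF this] obtain a where a: "\<And>b. b \<in> B \<Longrightarrow> a b \<in> Field \<Lambda> \<and> b \<in> Xs (a b)" by blast
  have "(\<Union>\<alpha>\<in>Field \<Lambda>. Xs \<alpha>) \<subseteq> (\<Union>b\<in>B. Xs (a b))"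
  proof
    fix x assume "x \<in> (\<Union>\<alpha>\<in>Field \<Lambda>. Xs \<alpha>)"
    then obtain \<alpha> where \<alpha>: "\<alpha> \<in> Field \<Lambda>" "x \<in> Xs \<alpha>" by blast
    then obtain b where b: "b \<in> B" "b \<notin> Xs \<alpha>" using no by blast
    then have "Xs \<alpha> \<subseteq> Xs (a b)"
      using chain_comparable[of \<Lambda> Xs \<alpha> "a b", OF \<Lambda> mono \<alpha>(1)] a b by blast
    then show "x \<in> (\<Union>b\<in>B. Xs (a b))" using \<alpha>(2) b(1) by blast
  qed
  moreover have "|\<Union>b\<in>B. Xs (a b)| \<le>o c"
    using small a by (intro UNION_Cinfinite_bound B(2) c) blast
  ultimately show False using big ordLeq_transitive[OF card_of_mono1] by blast
qed

text \<open>Nonemptiness of \<open>B\<close> ensures that the chain has a member at all.\<close>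

lemma finite_subset_in_chain:
  assumes \<Lambda>: "Well_order \<Lambda>"
    and mono: "\<And>\<alpha> \<beta>. (\<alpha>, \<beta>) \<in> \<Lambda> \<Longrightarrow> Xs \<alpha> \<subseteq> Xs \<beta>"
    and B: "finite B" "B \<noteq> {}" "B \<subseteq> (\<Union>\<alpha>\<in>Field \<Lambda>. Xs \<alpha>)"
  shows "\<exists>\<alpha>\<in>Field \<Lambda>. B \<subseteq> Xs \<alpha>"
proof -
  have "subset.chain UNIV (Xs ` Field \<Lambda>)"
    using chain_comparable[of \<Lambda> Xs, OF \<Lambda> mono] unfolding subset_chain_def by blast
  then show ?thesis
    using finite_subset_Union_chain[OF B(1,3)] B(2,3)
    by (metis UN_empty image_iff image_is_empty subset_empty)
qed

theorem theorem2p4: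
  fixes X :: "'a topology"
    and \<kappa> :: "'k rel"
    and \<Lambda> :: "'l rel"
    and Xs :: "'l \<Rightarrow> 'a set"
  assumes "Hausdorff_space X"
    and "Card_order \<kappa>"
    and "Well_order \<Lambda>"
    and "\<And>\<alpha> \<beta>. (\<alpha>, \<beta>) \<in> \<Lambda> \<Longrightarrow> Xs \<alpha> \<subseteq> Xs \<beta>"
    and "topspace X = (\<Union>\<alpha>\<in>Field \<Lambda>. Xs \<alpha>)"
    and "\<And>\<alpha>. \<alpha> \<in> Field \<Lambda> \<Longrightarrow>
           free_lindelof_number (subtopology X (Xs \<alpha>)) *c
           free_number (subtopology X (Xs \<alpha>)) *c
           pseudocharacter (subtopology X (Xs \<alpha>)) \<le>o \<kappa>"
  shows "|topspace X| \<le>o ctwo ^c \<kappa>"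
proof (cases "finite (Field \<kappa>)")
  case True
  \<comment> \<open>Finite sets are free, and the product dominates \<open>F\<close> as soon as there are two points.\<close>
  have card_le: "|B| \<le>o \<kappa>" if B: "finite B" "B \<subseteq> topspace X" "x \<in> B" "y \<in> B" "x \<noteq> y" for B x y
  proof -
    obtain \<alpha> where \<alpha>: "\<alpha> \<in> Field \<Lambda>" "B \<subseteq> Xs \<alpha>"
      using finite_subset_in_chain[of \<Lambda> Xs B, OF assms(3,4) B(1)] B(2,3) assms(5) by blast
    let ?Y = "subtopology X (Xs \<alpha>)"
    have Y: "Hausdorff_space ?Y" using assms(1) by (rule Hausdorff_space_subtopology)
    have BY: "B \<subseteq> topspace ?Y" using \<alpha>(2) B(2) by simp
    then have F: "free_number ?Y \<le>o \<kappa>"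
      using factors_le(2)[OF Y _ _ B(5) assms(6)[OF \<alpha>(1)]] B(3,4) by blast
    have "free_set ?Y B" by (rule free_set_finite[OF Hausdorff_imp_t1_space[OF Y] B(1) BY])
    then have "|B| \<le>o free_number ?Y" using free_number(2)[of ?Y] by blast
    then show ?thesis using F by (rule ordLeq_transitive)
  qed
  show ?thesis
  proof (cases "\<exists>x y. x \<in> topspace X \<and> y \<in> topspace X \<and> x \<noteq> y")
    case True
    then obtain x y where xy: "x \<in> topspace X" "y \<in> topspace X" "x \<noteq> y" by blast
    have "finite (topspace X)"
    proof (rule ccontr)
      assume "infinite (topspace X)"
      \<comment> \<open>One element more than \<open>Field \<kappa>\<close> suffices for the
        contradiction; \<open>x\<close> and \<open>y\<close> are inserted to provide the two points
        that \<open>card_le\<close> asks for.\<close>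
      then obtain B where B: "finite B" "card B = Suc (card (Field \<kappa>))" "B \<subseteq> topspace X"
        using infinite_arbitrarily_large by blast
      have "|insert x (insert y B)| \<le>o \<kappa>"
        using card_le[of "insert x (insert y B)" x y] B xy by simp
      then have "|insert x (insert y B)| \<le>o |Field \<kappa>|"
        by (rule iffD1[OF card_le_iff_card_Field[OF assms(2)]])
      then obtain f where "inj_on f (insert x (insert y B))" "f ` insert x (insert y B) \<subseteq> Field \<kappa>"
        unfolding card_of_ordLeq[symmetric] by blast
      then have "card (insert x (insert y B)) \<le> card (Field \<kappa>)"
        using \<open>finite (Field \<kappa>)\<close> by (rule card_inj_on_le)
      moreover have "card B \<le> card (insert x (insert y B))" using B(1) by (intro card_mono) auto
      ultimately show False using B(2) by simp
    qed
    then have "|topspace X| \<le>o \<kappa>" using card_le[OF _ subset_refl] xy by blast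
    then show ?thesis using le_two_power[OF assms(2)] by (rule ordLeq_transitive)
  next
    case False
    then have "topspace X \<subseteq> {SOME x. x \<in> topspace X}" by (metis singletonI someI subsetI)
    \<comment> \<open>Even for \<kappa> = 0 the power is at least 1, since the function set is
      nonempty.\<close>
    moreover have "|{SOME x. x \<in> topspace X}| \<le>o ctwo ^c \<kappa>"
      unfolding cexp_def ctwo_def Field_card_of by (intro card_of_singl_ordLeq Func_non_emp) simp
    ultimately show ?thesis by (rule ordLeq_transitive[OF card_of_mono1])
  qed
next
  case False
  then have \<kappa>: "Cinfinite \<kappa>" using assms(2) by (simp add: cinfinite_def)
  have sub: "Xs \<alpha> \<subseteq> topspace X" if "\<alpha> \<in> Field \<Lambda>" for \<alpha> using that assms(5) by blast
  have Y: "Hausdorff_space (subtopology X (Xs \<alpha>))" for \<alpha>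
    using assms(1) by (rule Hausdorff_space_subtopology)
  note inv = invariants_le[OF Y \<kappa> assms(6)]
  have small: "|Xs \<alpha>| \<le>o ctwo ^c \<kappa>" if "\<alpha> \<in> Field \<Lambda>" for \<alpha>
    using card_topspace_le_exp[OF Y \<kappa> inv[OF that]] sub[OF that] by (simp add: Int_absorb1)
  show ?thesis
  proof (rule ccontr)
    assume big: "\<not> ?thesis"
    \<comment> \<open>Capture is derived from \<open>big\<close>, so the interpretation lives inside
      the contradiction.\<close>
    interpret small_subsets_captured X \<kappa>
    proof
      fix B assume "B \<subseteq> topspace X" "|B| \<le>o ctwo ^c \<kappa>"
      then obtain \<alpha> where "\<alpha> \<in> Field \<Lambda>" "B \<subseteq> Xs \<alpha>"
        using subset_in_chain[of \<Lambda> Xs, OF assms(3,4) small Cinfinite_two_power[OF \<kappa>]] big assms(5) by metis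
      then show "\<exists>Y\<subseteq>topspace X. B \<subseteq> Y \<and> lindelof_number (subtopology X Y) \<le>o \<kappa> \<and>
        free_number (subtopology X Y) \<le>o \<kappa> \<and> pseudocharacter (subtopology X Y) \<le>o \<kappa>"
        by (intro exI[of _ "Xs \<alpha>"] conjI sub inv)
    qed (use assms(1) \<kappa> in simp_all)
    show False using big card_topspace_le by blast
  qed
qed

end
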